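(* Let $n$ be a positive odd integer, and let $M=(n-1)/2$ or $M=n-1$. Then $$\sum_{k=0}^{M}[4k+1]\frac{(q;q^2)_k^4}{(q^2;q^2)_k^4}q^{2k^2+k}\equiv[n]q^{(1-n)/2}\left\{1+[n]^2\frac{(n^2-1)(1-q)^2}{24}\right\}\sum_{k=0}^{(n-1)/2}\frac{(q;q^2)_k^3}{(q^2;q^2)_k^2}q^{2k}\pmod{[n]\Phi_n(q)^3}.$$
   Context: For a nonnegative integer $k$, $(x;q)_0=1$ and $(x;q)_k=(1-x)(1-xq)\cdots(1-xq^{k-1})$ for $k\ge 1$; the same notation is used with base $q$ replaced by $q^2$. $[m]=(1-q^m)/(1-q)$, and $\Phi_n(q)$ is the $n$-th cyclotomic polynomial in $q$. For rational functions $A,B\in\mathbb{Q}(q)$ and a polynomial $P\in\mathbb{Q}[q]$, $A\equiv B\pmod P$ means that $A-B$, written in lowest terms, has numerator divisible by $P$. *)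

theory Defs
  imports
    "HOL-Computational_Algebra.Computational_Algebra"
    "HOL-Computational_Algebra.Field_as_Ring"
begin

text \<open>
  The polynomial ring is \<^typ>\<open>rat poly\<close>; the field of rational functions in \<open>q\<close> is its field
  of fractions \<^typ>\<open>rat poly fract\<close>.
\<close>

definition qvar :: "rat poly fract" where
  "qvar = to_fract [:0, 1:]"

definition qpochhammer :: "'a::comm_ring_1 \<Rightarrow> 'a \<Rightarrow> nat \<Rightarrow> 'a" where
  "qpochhammer x q k = (\<Prod>i<k. 1 - x * q ^ i)"

text \<open>
  The number \<open>[m] = (1 - q^m) / (1 - q)\<close> is needed both as a rational function and, in the
  modulus, as a polynomial. The operation \<open>div\<close> is field division in the first case
  and (exact) polynomial division in the second; see \<open>to_fract_qint\<close> below.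
\<close>

definition qint :: "'a::idom_divide \<Rightarrow> nat \<Rightarrow> 'a" where
  "qint q m = (1 - q ^ m) div (1 - q)"

text \<open>
  For \<open>n > 0\<close>, the rational polynomial whose image over the complex numbers is the product
  of \<open>q - z\<close> over the primitive \<open>n\<close>-th roots of unity \<open>z\<close>. Its existence is proved in
  \<open>map_poly_cyclotomic\<close>.
\<close>

definition primitive_roots_unity :: "nat \<Rightarrow> complex set" where
  "primitive_roots_unity n = {z. z ^ n = 1 \<and> (\<forall>m. 0 < m \<and> m < n \<longrightarrow> z ^ m \<noteq> 1)}"

definition cyclotomic :: "nat \<Rightarrow> rat poly" where
  "cyclotomic n =
     (THE p. map_poly of_rat p = (\<Prod>z\<in>primitive_roots_unity n. [:- z, 1:]))"

text \<open>
  \<^const>\<open>quot_of_fract\<close> returns numerator and denominator in lowest terms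
  (coprime, with monic denominator).
\<close>

definition fract_cong :: "rat poly fract \<Rightarrow> rat poly fract \<Rightarrow> rat poly \<Rightarrow> bool" where
  "fract_cong A B P \<longleftrightarrow> P dvd fst (quot_of_fract (A - B))"


lemma qint_eq_sum:
  fixes q :: "'a::idom_divide"
  assumes "q \<noteq> 1"
  shows "qint q m = (\<Sum>i<m. q ^ i)"
proof -
  have "1 - q ^ m = (1 - q) * (\<Sum>i<m. q ^ i)"
    by (rule one_diff_power_eq)
  with assms show ?thesis
    by (simp add: qint_def)
qed

lemma to_fract_power: "to_fract (x ^ n) = to_fract x ^ n"
  by (induction n) simp_all

lemma to_fract_qint: "to_fract (qint [:0, 1:] m) = qint qvar m"
proof -
  have ne: "[:0, 1:] \<noteq> (1 :: rat poly)"
    by (simp add: one_pCons)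
  hence "qvar \<noteq> 1"
    unfolding qvar_def by (metis to_fract_1 to_fract_eq_iff)
  with ne show ?thesis
    by (simp add: qint_eq_sum qvar_def to_fract_power del: to_fract_sum)
       (simp add: to_fract_power)
qed

lemma finite_primitive_roots_unity: "n > 0 \<Longrightarrow> finite (primitive_roots_unity n)"
  by (rule finite_subset[OF _ finite_roots_unity[of n]])
     (auto simp: primitive_roots_unity_def)

lemma primitive_roots_unity_disjoint:
  assumes "z \<in> primitive_roots_unity m" "z \<in> primitive_roots_unity n" "m > 0" "n > 0"
  shows "m = n"
  using assms unfolding primitive_roots_unity_def
  by (metis (mono_tags, lifting) linorder_neqE_nat mem_Collect_eq)

lemma roots_unity_eq_Union:
  assumes "n > 0"
  shows "{z::complex. z ^ n = 1} = (\<Union>d\<in>{d. d dvd n}. primitive_roots_unity d)"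
proof (intro equalityI subsetI)
  fix z :: complex
  assume z: "z \<in> {z. z ^ n = 1}"
  define d where "d = (LEAST d. 0 < d \<and> z ^ d = 1)"
  have d: "0 < d \<and> z ^ d = 1"
    unfolding d_def by (rule LeastI[of _ n]) (use z assms in auto)
  have least: "z ^ m \<noteq> 1" if "0 < m" "m < d" for m
    using that not_less_Least[of m "\<lambda>d. 0 < d \<and> z ^ d = 1"] unfolding d_def by auto
  have "z ^ (d * (n div d) + n mod d) = z ^ (n mod d)"
    unfolding power_add power_mult using d by simp
  hence "z ^ (n mod d) = 1"
    using z by simp
  hence "n mod d = 0"
    using least[of "n mod d"] d by fastforce
  with d least show "z \<in> (\<Union>d\<in>{d. d dvd n}. primitive_roots_unity d)"
    unfolding primitive_roots_unity_def by auto
next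
  fix z assume "z \<in> (\<Union>d\<in>{d. d dvd n}. primitive_roots_unity d)"
  then show "z \<in> {z. z ^ n = 1}"
    by (auto simp: primitive_roots_unity_def power_mult elim!: dvdE)
qed

lemma poly_roots_unity:
  assumes "n > 0"
  shows "monom 1 n - 1 = (\<Prod>z\<in>{z::complex. z ^ n = 1}. [:- z, 1:])"
proof -
  let ?S = "{z::complex. z ^ n = 1}"
  let ?p = "monom 1 n - 1 :: complex poly" and ?r = "\<Prod>z\<in>?S. [:- z, 1:]"
  have fin: "finite ?S" and card: "card ?S = n"
    using assms by (simp_all add: finite_roots_unity card_roots_unity_eq)
  have dr: "degree ?r = n"
    using card by (simp add: degree_prod_eq_sum_degree)
  have "lead_coeff ?r = 1"
    unfolding lead_coeff_prod by simp
  with dr have cr: "coeff ?r n = 1"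
    by simp
  have cp: "coeff ?p n = 1"
    using assms by (simp add: coeff_pCons split: nat.splits)
  have dp: "degree ?p \<le> n"
    by (intro degree_diff_le) (simp_all add: degree_monom_le)
  show ?thesis
  proof (rule ccontr)
    assume "?p \<noteq> ?r"
    hence ne: "?p - ?r \<noteq> 0" by simp
    have "degree (?p - ?r) \<le> n"
      using degree_diff_le[OF dp, of ?r] dr by simp
    moreover have "coeff (?p - ?r) n = 0"
      using cp cr by simp
    ultimately have "degree (?p - ?r) < n"
      using ne by (metis leading_coeff_0_iff le_neq_implies_less)
    moreover have "?S \<subseteq> {z. poly (?p - ?r) z = 0}"
      using fin by (auto simp: poly_monom poly_prod)
    hence "card ?S \<le> card {z. poly (?p - ?r) z = 0}"
      using ne by (intro card_mono poly_roots_finite)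
    with card_poly_roots_bound[OF ne] have "n \<le> degree (?p - ?r)"
      using card by linarith
    ultimately show False by simp
  qed
qed

lemma poly_roots_unity_primitive:
  assumes "n > 0"
  shows "monom 1 n - 1 = (\<Prod>d | d dvd n. \<Prod>z\<in>primitive_roots_unity d. [:- z, 1:])"
proof -
  have pos: "d > 0" if "d dvd n" for d
    using that assms by (rule dvd_pos_nat[rotated])
  have "monom 1 n - 1 =
      (\<Prod>z\<in>(\<Union>d\<in>{d. d dvd n}. primitive_roots_unity d). [:- z, 1:])"
    using poly_roots_unity[OF assms] roots_unity_eq_Union[OF assms] by simp
  also have "\<dots> = (\<Prod>d | d dvd n. \<Prod>z\<in>primitive_roots_unity d. [:- z, 1:])"
  proof (rule prod.UNION_disjoint)
    show "finite {d. d dvd n}"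
      using assms by simp
    show "\<forall>d\<in>{d. d dvd n}. finite (primitive_roots_unity d)"
      using pos finite_primitive_roots_unity by blast
    show "\<forall>i\<in>{d. d dvd n}. \<forall>j\<in>{d. d dvd n}. i \<noteq> j \<longrightarrow>
        primitive_roots_unity i \<inter> primitive_roots_unity j = {}"
      using pos primitive_roots_unity_disjoint by blast
  qed
  finally show ?thesis .
qed

abbreviation rat_to_complex_poly :: "rat poly \<Rightarrow> complex poly" where
  "rat_to_complex_poly \<equiv> map_poly of_rat"

lemma rat_to_complex_poly_add:
  "rat_to_complex_poly (p + q) = rat_to_complex_poly p + rat_to_complex_poly q"
  by (intro poly_eqI) (simp add: coeff_map_poly of_rat_add)

lemma rat_to_complex_poly_mult:
  "rat_to_complex_poly (p * q) = rat_to_complex_poly p * rat_to_complex_poly q"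
  by (intro poly_eqI) (simp add: coeff_map_poly coeff_mult of_rat_sum of_rat_mult)

lemma rat_to_complex_poly_prod:
  "rat_to_complex_poly (\<Prod>x\<in>A. f x) = (\<Prod>x\<in>A. rat_to_complex_poly (f x))"
  by (induction A rule: infinite_finite_induct) (simp_all add: rat_to_complex_poly_mult)

lemma rat_to_complex_poly_inj:
  "rat_to_complex_poly p = rat_to_complex_poly q \<longleftrightarrow> p = q"
  by (auto simp: poly_eq_iff coeff_map_poly)

lemma degree_rat_to_complex_poly: "degree (rat_to_complex_poly p) = degree p"
  by (rule degree_map_poly) simp

lemma rat_poly_primitive_roots_unity:
  assumes "n > 0"
  shows "\<exists>p. rat_to_complex_poly p = (\<Prod>z\<in>primitive_roots_unity n. [:- z, 1:])"
  using assms
proof (induction n rule: less_induct)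
  case (less n)
  let ?C = "\<lambda>d. \<Prod>z\<in>primitive_roots_unity d. [:- z, 1:]"
  define D where "D = {d. d dvd n} - {n}"
  have "\<exists>p. rat_to_complex_poly p = ?C d" if "d \<in> D" for d
    using that less.prems by (intro less.IH) (auto simp: D_def dvd_pos_nat dest: dvd_imp_le intro: le_neq_implies_less)
  then obtain f where f: "\<And>d. d \<in> D \<Longrightarrow> rat_to_complex_poly (f d) = ?C d"
    by metis
  define Q where "Q = (\<Prod>d\<in>D. f d)"
  have Q: "rat_to_complex_poly Q = (\<Prod>d\<in>D. ?C d)"
    by (simp add: Q_def rat_to_complex_poly_prod f)
  define R :: "rat poly" where "R = monom 1 n - 1"
  have "rat_to_complex_poly R = monom 1 n - 1"
    unfolding R_def
    by (intro poly_eqI) (simp add: coeff_map_poly of_rat_diff coeff_pCons split: nat.splits)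
  also have "\<dots> = (\<Prod>d | d dvd n. ?C d)"
    by (rule poly_roots_unity_primitive) fact
  also have "\<dots> = ?C n * (\<Prod>d\<in>D. ?C d)"
    unfolding D_def by (rule prod.remove) (use less.prems in auto)
  finally have R: "rat_to_complex_poly R = ?C n * rat_to_complex_poly Q"
    by (simp add: Q)
  have "rat_to_complex_poly R =
      rat_to_complex_poly (R div Q) * rat_to_complex_poly Q + rat_to_complex_poly (R mod Q)"
    by (simp flip: rat_to_complex_poly_mult rat_to_complex_poly_add)
  with R have eq: "(?C n - rat_to_complex_poly (R div Q)) * rat_to_complex_poly Q =
      rat_to_complex_poly (R mod Q)"
    by (simp add: algebra_simps)
  have "rat_to_complex_poly Q \<noteq> 0"
  proof
    assume "rat_to_complex_poly Q = 0"
    then obtain d where "d \<in> D" "?C d = 0"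
      unfolding Q by (metis (no_types, lifting) prod.infinite prod_zero_iff zero_neq_one)
    then obtain z :: complex where "[:- z, 1:] = 0"
      by (metis (no_types, lifting) prod.infinite prod_zero_iff zero_neq_one)
    thus False by simp
  qed
  hence Q0: "Q \<noteq> 0" by auto
  have "?C n - rat_to_complex_poly (R div Q) = 0"
  proof (rule ccontr)
    assume ne: "?C n - rat_to_complex_poly (R div Q) \<noteq> 0"
    have "degree Q \<le> degree (rat_to_complex_poly (R mod Q))"
      unfolding eq[symmetric] using ne \<open>rat_to_complex_poly Q \<noteq> 0\<close>
      by (simp add: degree_mult_eq degree_rat_to_complex_poly)
    moreover have "R mod Q \<noteq> 0"
      using eq ne \<open>rat_to_complex_poly Q \<noteq> 0\<close> by auto
    ultimately show False
      using degree_mod_less[OF Q0, of R] by (simp add: degree_rat_to_complex_poly)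
  qed
  then show ?case
    by (intro exI[of _ "R div Q"]) simp
qed

lemma map_poly_cyclotomic:
  assumes "n > 0"
  shows "map_poly of_rat (cyclotomic n) = (\<Prod>z\<in>primitive_roots_unity n. [:- z, 1:])"
proof -
  obtain p where p: "rat_to_complex_poly p = (\<Prod>z\<in>primitive_roots_unity n. [:- z, 1:])"
    using rat_poly_primitive_roots_unity[OF assms] by blast
  have "\<exists>!p. rat_to_complex_poly p = (\<Prod>z\<in>primitive_roots_unity n. [:- z, 1:])"
    using p by (metis rat_to_complex_poly_inj)
  from theI'[OF this] show ?thesis
    by (simp add: cyclotomic_def)
qed

end

theory Submission
  imports Defs
begin

text \<open>
  Fix a primitive \<open>n\<close>-th root of unity \<open>z\<close>, and write \<open>n = 2 m + 1\<close>, \<open>y = q^n\<close>. Replace three of the four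
  factors \<open>(q;q^2)_k / (q^2;q^2)_k\<close> of a summand by \<open>(q u;q^2)_k / (q^2/u;q^2)_k\<close> for three values
  of \<open>u\<close>: the value \<open>1/y\<close> and the two roots of \<open>u^2 - (3 y - y^2) u + y\<close>. These have product 1, their
  second elementary symmetric function is 3, and the first one differs from 3 by
  \<open>\<delta> = (1 - y)^3 / y\<close>. The perturbed sum terminates at \<open>k = m\<close> and is evaluated exactly by a limit
  of Watson's transformation. It differs from the original one by \<open>\<delta>\<close> times a sum whose value at
  \<open>z\<close> is 0, because the summands are antisymmetric and the weights symmetric under \<open>k \<mapsto> m - k\<close>;
  so the difference has order four at \<open>z\<close>. The factor \<open>(n^2 - 1) / 24\<close> comes from the sum of
  \<open>t / (1 - t)^2\<close> over \<open>t = z^2, z^4, \<dots>, z^(2 m)\<close>. At a primitive \<open>d\<close>-th root of unity with \<open>d\<close> a proper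
  divisor of \<open>n\<close>, the sum splits into blocks of length \<open>d\<close>, each of which vanishes by the same
  antisymmetry.
\<close>

section \<open>Gaussian binomial coefficients and the transformation formula\<close>

text \<open>Why these values of u: let e1, e2, e3 be the elementary symmetric functions of three
  values, one of which is 1/y, as termination at k = m requires. Expanding the product of the
  factors 1 - u y, which is 0, gives (e1 - 3) y - (e2 - 3) y^2 + (e3 - 1) y^3 = (1 - y)^3. The
  balancing condition of the transformation is e3 = 1, and e2 = 3 then puts the whole deviation into
  e1, where it has order three. The more obvious triple 1/y, 1, y gives e1 = e2 = 3 + (1 - y)^2 / y,
  a deviation of order two only. Antisymmetry contributes a single further order, so that choice
  would stop at order three. The price is that the other two values are not rational functions:
  their quadratic has discriminant y (y - 4) (1 - y)^2, not a square in Q(q) since n is odd. Hence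
  all identities are stated through the coefficients of quadratics and never through their
  roots.\<close>

lemma qpochhammer_0 [simp]: "qpochhammer x q 0 = 1"
  by (simp add: qpochhammer_def)

lemma qpochhammer_Suc: "qpochhammer x q (Suc k) = qpochhammer x q k * (1 - x * q ^ k)"
  by (simp add: qpochhammer_def)

lemma qpochhammer_add:
  "qpochhammer x q (k + l) = qpochhammer x q k * qpochhammer (x * q ^ k) q l"
  by (induction l) (simp_all add: qpochhammer_Suc power_add algebra_simps)

lemma qpochhammer_Suc': "qpochhammer x q (Suc k) = (1 - x) * qpochhammer (x * q) q k"
  using qpochhammer_add[of x q 1 k] by (simp add: qpochhammer_def)

lemma qpochhammer_nonzero:
  fixes x :: "'a::idom"
  assumes "\<And>i. i < k \<Longrightarrow> x * q ^ i \<noteq> 1"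
  shows "qpochhammer x q k \<noteq> 0"
  using assms by (force simp: qpochhammer_def)

text \<open>The Gaussian binomial coefficient through the q-Pascal rule, hence a polynomial in
  \<open>p\<close>: it keeps a value at roots of unity, where the quotient of q-factorials may read
  0 / 0.\<close>

fun qbinomial :: "'a::comm_ring_1 \<Rightarrow> nat \<Rightarrow> nat \<Rightarrow> 'a" where
  "qbinomial p n 0 = 1"
| "qbinomial p 0 (Suc k) = 0"
| "qbinomial p (Suc n) (Suc k) = qbinomial p n k + p ^ Suc k * qbinomial p n (Suc k)"

lemma qbinomial_eq_0: "n < k \<Longrightarrow> qbinomial p n k = 0"
  by (induction p n k rule: qbinomial.induct) auto

lemma qbinomial_self [simp]: "qbinomial p n n = 1"
  by (induction n) (simp_all add: qbinomial_eq_0)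

text \<open>The ratio of neighbouring coefficients, multiplied out so that nothing is inverted.
  Added to the recursion it yields the second q-Pascal rule.\<close>

lemma qbinomial_absorb:
  "k \<le> n \<Longrightarrow> (1 - p ^ Suc k) * qbinomial p n (Suc k) = (1 - p ^ (n - k)) * qbinomial p n k"
proof (induction n arbitrary: k)
  case 0
  then show ?case by simp
next
  case (Suc n)
  show ?case
  proof (cases k)
    case 0
    have "(1 - p) * qbinomial p (Suc n) (Suc 0) = (1 - p) + p * ((1 - p) * qbinomial p n (Suc 0))"
      by (simp add: algebra_simps)
    also have "(1 - p) * qbinomial p n (Suc 0) = 1 - p ^ n"
      using Suc.IH[of 0] by simp
    finally show ?thesis
      using 0 by (simp add: algebra_simps)
  next
    case (Suc k')
    show ?thesis
    proof (cases "k' = n")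
      case True
      then show ?thesis
        using Suc by (simp add: qbinomial_eq_0)
    next
      case False
      then obtain r where r: "n = Suc k' + r"
        using Suc Suc.prems less_imp_Suc_add[of k' n] by fastforce
      define b0 b1 b2 where
        "b0 = qbinomial p n k'" and "b1 = qbinomial p n (Suc k')" and "b2 = qbinomial p n (Suc (Suc k'))"
      have e2: "(1 - p ^ Suc (Suc k')) * b2 = (1 - p ^ r) * b1"
        using Suc.IH[of "Suc k'"] r by (simp add: b1_def b2_def)
      have e1: "(1 - p ^ Suc k') * b1 = (1 - p ^ Suc r) * b0"
        using Suc.IH[of "k'"] r by (simp add: b1_def b0_def)
      have "(1 - p ^ Suc (Suc k')) * (b1 + p ^ Suc (Suc k') * b2) =
          (1 - p ^ Suc (Suc k')) * b1 + p ^ Suc (Suc k') * ((1 - p ^ Suc (Suc k')) * b2)"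
        by (simp add: algebra_simps)
      also have "\<dots> = (1 - p ^ Suc k') * b1 + p ^ Suc k' * (1 - p ^ Suc r) * b1"
        unfolding e2 by (simp add: algebra_simps power_add)
      also have "\<dots> = (1 - p ^ Suc r) * (b0 + p ^ Suc k' * b1)"
        unfolding e1 by (simp add: algebra_simps)
      finally show ?thesis
        using Suc r by (simp add: b0_def b1_def b2_def)
    qed
  qed
qed

lemma qbinomial_Suc_Suc':
  assumes "k \<le> n"
  shows "qbinomial p (Suc n) (Suc k) = p ^ (n - k) * qbinomial p n k + qbinomial p n (Suc k)"
  using qbinomial_absorb[OF assms, of p] by (simp add: algebra_simps)

lemma qpochhammer_qbinomial:
  "qbinomial p (k + l) k * (qpochhammer p p k * qpochhammer p p l) = qpochhammer p p (k + l)"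
proof (induction k arbitrary: l)
  case 0
  then show ?case by simp
next
  case (Suc k)
  have "(1 - p ^ Suc k) * qbinomial p (Suc k + l) (Suc k) =
      (1 - p ^ Suc l) * qbinomial p (k + Suc l) k"
    using qbinomial_absorb[of k "Suc k + l" p] by (simp add: algebra_simps)
  then have "qbinomial p (Suc k + l) (Suc k) * (qpochhammer p p (Suc k) * qpochhammer p p l)
     = qbinomial p (k + Suc l) k * (qpochhammer p p k * qpochhammer p p (Suc l))"
    by (simp only: qpochhammer_Suc mult_ac power_Suc)
  also have "\<dots> = qpochhammer p p (k + Suc l)"
    by (rule Suc.IH)
  finally show ?case
    by simp
qed

text \<open>
  The \<open>q\<close>-Pfaff--Saalschuetz sum, read as the expansion of one product of quadratics
  \<open>(1 - \<alpha> p^i) (1 - \<beta> p^i)\<close>, with \<open>x = \<alpha> + \<beta>\<close> and \<open>c = \<alpha> \<beta>\<close>, in the Newton basis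
  given by the products of the same quadratics shifted by \<open>\<sigma>\<close>.
\<close>

lemma q_saalschuetz:
  fixes p c x \<sigma> :: "'a::field"
  assumes "\<sigma> \<noteq> 0"
  shows "(\<Prod>i<M. 1 - x * p ^ i + c * p ^ (2 * i)) =
    (\<Sum>j\<le>M. qbinomial p M j * qpochhammer (c * \<sigma> * p ^ j) p (M - j) *
       qpochhammer (1 / \<sigma>) p (M - j) / \<sigma> ^ j *
       (\<Prod>l<j. 1 - x * \<sigma> * p ^ l + c * \<sigma> ^ 2 * p ^ (2 * l)))"
proof (induction M)
  case 0
  then show ?case by simp
next
  case (Suc M)
  define f where "f = (\<lambda>M j. qbinomial p M j * qpochhammer (c * \<sigma> * p ^ j) p (M - j) *
       qpochhammer (1 / \<sigma>) p (M - j) / \<sigma> ^ j)"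
  define V where "V = (\<lambda>j. \<Prod>l<j. 1 - x * \<sigma> * p ^ l + c * \<sigma> ^ 2 * p ^ (2 * l))"
  define Y where "Y = 1 - x * p ^ M + c * p ^ (2 * M)"
  define u where "u = (\<lambda>j. p ^ (M - j) / \<sigma>)"
  define v where "v = (\<lambda>j. (1 - p ^ (M - j) / \<sigma>) * (1 - c * \<sigma> * p ^ (M + j)))"
  \<comment> \<open>One step of the Newton expansion: \<open>u j\<close> is the multiplier of the
    shifted quadratic for which the terms in \<open>x\<close> cancel, and the remainder factors as
    \<open>v j\<close>.\<close>
  have YV: "Y * V j = u j * V (Suc j) + v j * V j" if jM: "j \<le> M" for j
  proof -
    obtain r where r: "M = j + r" using le_Suc_ex[OF jM] by blast
    have "Y = u j * (1 - x * \<sigma> * p ^ j + c * \<sigma> ^ 2 * p ^ (2 * j)) + v j"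
    proof -
      define y t where "y = p ^ j" and "t = p ^ r / \<sigma>"
      have "p ^ r = t * \<sigma>" using assms by (simp add: t_def)
      then have M: "p ^ M = y * (t * \<sigma>)"
        by (simp add: r y_def power_add)
      have "p ^ (2 * M) = (y * (t * \<sigma>)) * (y * (t * \<sigma>))" "p ^ (2 * j) = y * y"
        by (simp_all only: power_even_eq power2_eq_square M y_def)
      moreover have "p ^ (M - j) / \<sigma> = t" "p ^ (M + j) = y * (t * \<sigma>) * y"
        using M by (simp_all add: r t_def y_def power_add)
      ultimately show ?thesis
        using M unfolding Y_def u_def v_def
        by (simp only: y_def[symmetric] power2_eq_square) (simp add: algebra_simps)
    qed
    moreover have "V (Suc j) = V j * (1 - x * \<sigma> * p ^ j + c * \<sigma> ^ 2 * p ^ (2 * j))"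
      by (simp add: V_def)
    ultimately show ?thesis
      by (simp add: distrib_left distrib_right mult_ac)
  qed
  have f0: "f (Suc M) 0 = f M 0 * v 0"
    by (simp add: f_def v_def qpochhammer_Suc algebra_simps)
  have fS: "f (Suc M) (Suc j) = f M j * u j + f M (Suc j) * v (Suc j)" if jM: "j \<le> M" for j
  proof (cases "j = M")
    case True
    then show ?thesis by (simp add: f_def u_def qbinomial_eq_0)
  next
    case False
    then obtain r where r: "M = Suc j + r"
      using jM less_imp_Suc_add[of j M] by fastforce
    define b0 b1 where "b0 = qbinomial p M j" and "b1 = qbinomial p M (Suc j)"
    define X Z where "X = qpochhammer (c * \<sigma> * p ^ Suc j) p r" and "Z = qpochhammer (1 / \<sigma>) p r"
    have pa1: "qbinomial p (Suc M) (Suc j) = b0 + p ^ Suc j * b1"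
      by (simp add: b0_def b1_def)
    have pa2: "b0 + p ^ Suc j * b1 = p ^ Suc r * b0 + b1"
      using qbinomial_Suc_Suc'[OF jM, of p] r by (simp add: b0_def b1_def)
    have 1: "f (Suc M) (Suc j) = (b0 + p ^ Suc j * b1) * (X * (1 - c * \<sigma> * p ^ M)) *
        (Z * (1 - p ^ r / \<sigma>)) / \<sigma> ^ Suc j"
    proof -
      have "c * \<sigma> * p ^ Suc j * p ^ r = c * \<sigma> * p ^ M" "Suc M - Suc j = Suc r" "1 / \<sigma> * p ^ r = p ^ r / \<sigma>"
        using r by (simp_all add: power_add)
      then show ?thesis
        unfolding f_def pa1 X_def Z_def by (simp only: qpochhammer_Suc)
    qed
    have 2: "f M j = b0 * ((1 - c * \<sigma> * p ^ j) * X) * (Z * (1 - p ^ r / \<sigma>)) / \<sigma> ^ j"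
    proof -
      have "c * \<sigma> * p ^ j * p = c * \<sigma> * p ^ Suc j" "M - j = Suc r" "1 / \<sigma> * p ^ r = p ^ r / \<sigma>"
        using r by simp_all
      then show ?thesis
        unfolding f_def b0_def X_def Z_def
        by (simp only: qpochhammer_Suc[of "1 / \<sigma>"] qpochhammer_Suc'[of "c * \<sigma> * p ^ j"])
    qed
    have 3: "f M (Suc j) = b1 * X * Z / \<sigma> ^ Suc j"
      using r by (simp add: f_def b1_def X_def Z_def)
    have 4: "u j = p ^ Suc r / \<sigma>" "v (Suc j) = (1 - p ^ r / \<sigma>) * (1 - c * \<sigma> * p ^ (M + Suc j))"
      using r by (simp_all add: u_def v_def)
    \<comment> \<open>In powers of \<open>c\<close>: the constant terms agree by the second q-Pascal
      rule, the linear terms already in the form given by the first.\<close>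
    have "(b0 + p ^ Suc j * b1) * (1 - c * \<sigma> * p ^ M) =
      b0 * (1 - c * \<sigma> * p ^ j) * p ^ Suc r + b1 * (1 - c * \<sigma> * p ^ (M + Suc j))"
    proof -
      have "(b0 + p ^ Suc j * b1) * (1 - c * \<sigma> * p ^ M) =
        (p ^ Suc r * b0 + b1) - (b0 + p ^ Suc j * b1) * (c * \<sigma> * p ^ M)"
        using pa2 by (simp add: algebra_simps)
      also have "\<dots> = b0 * (1 - c * \<sigma> * p ^ j) * p ^ Suc r + b1 * (1 - c * \<sigma> * p ^ (M + Suc j))"
        by (simp add: r algebra_simps power_add)
      finally show ?thesis .
    qed
    then have "f (Suc M) (Suc j) = (b0 * (1 - c * \<sigma> * p ^ j) * p ^ Suc r +
        b1 * (1 - c * \<sigma> * p ^ (M + Suc j))) * (X * Z * (1 - p ^ r / \<sigma>) / \<sigma> ^ Suc j)"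
      unfolding 1 by (simp add: mult_ac)
    also have "\<dots> = f M j * u j + f M (Suc j) * v (Suc j)"
      unfolding 2 3 4 using assms by (simp add: field_simps)
    finally show ?thesis .
  qed
  have fM: "f M (Suc M) = 0"
    by (simp add: f_def qbinomial_eq_0)
  have "(\<Prod>i<Suc M. 1 - x * p ^ i + c * p ^ (2 * i)) = Y * (\<Sum>j\<le>M. f M j * V j)"
    using Suc.IH by (simp add: Y_def f_def V_def)
  also have "\<dots> = (\<Sum>j\<le>M. f M j * (Y * V j))"
    by (simp add: sum_distrib_left mult_ac)
  also have "\<dots> = (\<Sum>j\<le>M. f M j * u j * V (Suc j)) + (\<Sum>j\<le>M. f M j * v j * V j)"
    by (simp add: YV sum.distrib[symmetric] algebra_simps)
  also have "(\<Sum>j\<le>M. f M j * v j * V j) = (\<Sum>j\<le>Suc M. f M j * v j * V j)"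
    by (simp add: fM)
  also have "\<dots> = f M 0 * v 0 * V 0 + (\<Sum>j\<le>M. f M (Suc j) * v (Suc j) * V (Suc j))"
    by (rule sum.atMost_Suc_shift)
  also have "(\<Sum>j\<le>M. f M j * u j * V (Suc j)) + \<dots> =
      f (Suc M) 0 * V 0 + (\<Sum>j\<le>M. f (Suc M) (Suc j) * V (Suc j))"
    by (simp add: f0 fS sum.distrib algebra_simps)
  also have "\<dots> = (\<Sum>j\<le>Suc M. f (Suc M) j * V j)"
    by (rule sum.atMost_Suc_shift[symmetric])
  finally show ?case
    unfolding f_def V_def .
qed

text \<open>In Bailey's language, the pair with beta_j = 1 / (p;p)_j, one step along the chain from
  the unit pair; equivalently a limit of the terminating very-well-poised 6-phi-5 sum. The proof
  shows that the sum does not depend on \<open>j\<close>.\<close>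

lemma q_bailey_unit:
  fixes a p :: "'a::field"
  assumes a: "\<And>i. a * p ^ i \<noteq> 1"
  shows "(\<Sum>k\<le>j. qbinomial p j k * (- a) ^ k * p ^ (k ^ 2 + (k choose 2)) *
     (1 - a * p ^ (2 * k)) / qpochhammer (a * p ^ k) p (Suc j)) = 1"
proof (induction j)
  case 0
  then show ?case using a[of 0] by (simp add: qpochhammer_def binomial_eq_0)
next
  case (Suc j)
  define e where "e = (\<lambda>k. (- a) ^ k * p ^ (k ^ 2 + (k choose 2)))"
  define F where "F = (\<lambda>j k. qbinomial p j k * e k *
     (1 - a * p ^ (2 * k)) / qpochhammer (a * p ^ k) p (Suc j))"
  \<comment> \<open>A certificate of Wilf-Zeilberger type: the change of \<open>F\<close> from
    \<open>j\<close> to \<open>Suc j\<close> is the difference of \<open>G\<close> in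
    \<open>k\<close>. It is 0 at \<open>k = 0\<close>, and its value at \<open>Suc j\<close> cancels
    the new last summand.\<close>
  define G where "G = (\<lambda>k. case k of 0 \<Rightarrow> 0 | Suc k' \<Rightarrow>
     - (e k * p ^ (j - k') * qbinomial p j k' / qpochhammer (a * p ^ k) p (Suc j)))"
  have eS: "e (Suc k) = - (a * p ^ (3 * k + 1) * e k)" for k
  proof -
    have eq: "(Suc k)\<^sup>2 + (Suc k choose 2) = (k ^ 2 + (k choose 2)) + (3 * k + 1)"
      by (simp add: power2_eq_square numeral_2_eq_2)
    have "e (Suc k) = (- a) ^ Suc k * (p ^ (k ^ 2 + (k choose 2)) * p ^ (3 * k + 1))"
      unfolding e_def eq power_add[of p "k ^ 2 + (k choose 2)"] ..
    then show ?thesis by (simp add: e_def mult_ac)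
  qed
  have nz: "qpochhammer (a * p ^ k) p l \<noteq> 0" for k l
    by (rule qpochhammer_nonzero) (use a in \<open>simp add: mult.assoc flip: power_add\<close>)
  have step: "F (Suc j) k - F j k = G (Suc k) - G k" if "k \<le> j" for k
  proof -
    define Q where "Q = qpochhammer (a * p ^ Suc k) p j"
    define B where "B = qbinomial p j k"
    define B' where "B' = (case k of 0 \<Rightarrow> 0 | Suc k' \<Rightarrow> qbinomial p j k')"
    define s where "s = p ^ (Suc j - k)"
    define t where "t = p ^ (j - k)"
    define y where "y = p ^ k"
    define w where "w = 1 - a * p ^ (k + Suc j)"
    define v where "v = 1 - a * y"
    have nonzero: "v \<noteq> 0" "w \<noteq> 0" "Q \<noteq> 0"
      using a[of k] a[of "k + Suc j"] nz[of "Suc k" j] by (simp_all add: w_def v_def y_def Q_def)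
    have ap: "a * p ^ k * p = a * p ^ Suc k" "a * p ^ Suc k * p ^ j = a * p ^ (k + Suc j)"
      by (simp_all add: power_add)
    have q1: "qpochhammer (a * p ^ k) p (Suc j) = v * Q"
      by (simp only: qpochhammer_Suc' ap Q_def v_def y_def)
    have q2: "qpochhammer (a * p ^ k) p (Suc (Suc j)) = v * (Q * w)"
      by (simp only: qpochhammer_Suc'[of "a * p ^ k" p "Suc j"] ap
        qpochhammer_Suc[of "a * p ^ Suc k"] Q_def w_def v_def y_def)
    have q3: "qpochhammer (a * p ^ Suc k) p (Suc j) = Q * w"
      by (simp only: qpochhammer_Suc ap Q_def w_def)
    have st: "s = p * t" "y * t = p ^ j"
      using that by (simp_all add: s_def t_def y_def Suc_diff_le flip: power_add)
    have w_eq: "w = 1 - a * y * y * t * p"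
      using st by (simp add: w_def power_add y_def[symmetric] mult_ac)
    have pascal: "qbinomial p (Suc j) k = s * B' + B"
    proof (cases k)
      case (Suc k')
      then show ?thesis
        using qbinomial_Suc_Suc'[of k' j p] that by (simp add: s_def B'_def B_def)
    qed (simp add: B'_def B_def)
    have absorb: "(1 - y) * B = (1 - s) * B'"
    proof (cases k)
      case (Suc k')
      then show ?thesis
        using qbinomial_absorb[of k' j p] that by (simp add: s_def B'_def B_def y_def)
    qed (simp add: B'_def y_def)
    have y2: "p ^ (2 * k) = y * y" "p ^ (3 * k + 1) = y * y * y * p"
      by (simp_all add: y_def power_add power_mult numeral_3_eq_3 numeral_2_eq_2 power_mult_distrib)
    have G1: "G (Suc k) = a * (y * y * y * p) * e k * t * B / (Q * w)"
      by (simp add: G_def eS y2[simplified] q3[simplified] flip: B_def t_def)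
    have G0: "G k = - (e k * s * B' / (v * Q))"
      by (cases k) (simp_all add: G_def B'_def q1[symmetric] s_def)
    have F1: "F (Suc j) k = (s * B' + B) * e k * (1 - a * (y * y)) / (v * (Q * w))"
      by (simp add: F_def pascal q2 y2)
    have F0: "F j k = B * e k * (1 - a * (y * y)) / (v * Q)"
      by (simp add: F_def q1 y2 B_def)
    \<comment> \<open>The two sides differ by a multiple of \<open>absorb\<close>, the relation that
      ties \<open>B'\<close> to \<open>B\<close>.\<close>
    have key: "(1 - a * (y * y)) * (s * B' + B - B * w) =
        a * (y * y * y * p) * t * B * v + s * B' * w"
    proof -
      have "a * (y * y * y * p) * t * B * v + s * B' * w
          - (1 - a * (y * y)) * (s * B' + B - B * w)
        = a * y * y * t * p * ((1 - s) * B' - (1 - y) * B)"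
        unfolding w_eq st v_def by (simp add: algebra_simps)
      then show ?thesis
        using absorb by simp
    qed
    have "(F (Suc j) k - F j k) * (v * (Q * w)) =
       e k * ((1 - a * (y * y)) * (s * B' + B - B * w))"
      unfolding F1 F0 using nonzero by (simp add: field_simps)
    also have "\<dots> = (G (Suc k) - G k) * (v * (Q * w))"
      unfolding G1 G0 key using nonzero by (simp add: field_simps)
    finally show ?thesis
      using nonzero by (simp del: right_minus_eq diff_eq_diff_eq)
  qed
  have last: "F (Suc j) (Suc j) = - G (Suc j)"
  proof -
    have "1 - a * p ^ (2 * Suc j) \<noteq> 0"
      using a[of "2 * Suc j"] by simp
    moreover have "qpochhammer (a * p ^ Suc j) p (Suc (Suc j)) =
       qpochhammer (a * p ^ Suc j) p (Suc j) * (1 - a * p ^ (2 * Suc j))"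
      unfolding qpochhammer_Suc[of _ _ "Suc j"] by (simp add: mult_2 power_add mult.assoc)
    ultimately show ?thesis
      by (simp add: F_def G_def)
  qed
  have "(\<Sum>k\<le>Suc j. F (Suc j) k) - (\<Sum>k\<le>j. F j k) =
      (\<Sum>k<Suc j. F (Suc j) k - F j k) + F (Suc j) (Suc j)"
    by (simp add: sum_subtractf lessThan_Suc_atMost)
  also have "(\<Sum>k<Suc j. F (Suc j) k - F j k) = (\<Sum>k<Suc j. G (Suc k) - G k)"
    by (intro sum.cong) (auto intro: step)
  also have "\<dots> = G (Suc j)"
    by (simp only: sum_lessThan_telescope) (simp add: G_def)
  finally have "(\<Sum>k\<le>Suc j. F (Suc j) k) = (\<Sum>k\<le>j. F j k)"
    using last by simp
  then show ?case
    using Suc.IH by (simp add: F_def e_def mult.assoc)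
qed

section \<open>Coefficients of the transformation formula\<close>

lemma choose_two_add: "(i + r) choose 2 = (i choose 2) + (r choose 2) + i * r"
  by (induction i) (simp_all add: numeral_2_eq_2 algebra_simps binomial_eq_0)

lemma double_choose_two: "2 * (i choose 2) + i = i * i"
  by (induction i) (simp_all add: numeral_2_eq_2 algebra_simps binomial_eq_0)

text \<open>Each factor \<open>1 - 1 / p ^ j\<close> equals \<open>- (1 - p ^ j) / p ^ j\<close>;
  this turns the product with negative exponents into a quotient of q-factorials. The denominators
  are cleared.\<close>

lemma qpochhammer_neg_power:
  fixes p :: "'a::field"
  assumes "p \<noteq> 0"
  shows "qpochhammer (1 / p ^ (i + r)) p i * qpochhammer p p r * p ^ ((i + r) * i) =
    (-1) ^ i * p ^ (i choose 2) * qpochhammer p p (i + r)"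
proof (induction i)
  case 0
  then show ?case by (simp add: binomial_eq_0)
next
  case (Suc i)
  define N where "N = Suc i + r"
  have e: "p ^ (N * Suc i) = p ^ N * (p ^ ((i + r) * i) * p ^ i)"
    by (simp add: N_def flip: power_add) (simp add: algebra_simps)
  have c: "p ^ (Suc i choose 2) = p ^ i * p ^ (i choose 2)"
    by (simp add: numeral_2_eq_2 power_add)
  have q: "qpochhammer (1 / p ^ N) p (Suc i) = (1 - 1 / p ^ N) * qpochhammer (1 / p ^ (i + r)) p i"
    using assms by (simp add: qpochhammer_Suc' N_def)
  have P: "qpochhammer p p N = qpochhammer p p (i + r) * (1 - p ^ N)"
    by (simp add: N_def qpochhammer_Suc)
  have "qpochhammer (1 / p ^ N) p (Suc i) * qpochhammer p p r * p ^ (N * Suc i) =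
      ((1 - 1 / p ^ N) * p ^ N) * p ^ i *
      (qpochhammer (1 / p ^ (i + r)) p i * qpochhammer p p r * p ^ ((i + r) * i))"
    unfolding e q by (simp only: mult_ac)
  also have "(1 - 1 / p ^ N) * p ^ N = - (1 - p ^ N)"
    using assms by (simp add: field_simps)
  finally show ?case
    unfolding Suc.IH N_def[symmetric] c P
    by (simp only: power_Suc mult_minus_left mult_minus_right mult_1_left mult_ac)
qed

text \<open>After the tail of the \<open>k\<close>-th summand is expanded, the left side is the
  coefficient of the basis product with index \<open>j = k + l\<close>. On the right the dependence
  on \<open>k\<close> at fixed \<open>j\<close> is confined to a summand of
  \<open>q_bailey_unit\<close>, so that summing over \<open>k\<close> removes it.\<close>

lemma q_watson_coefficient:
  fixes a p :: "'a::field" and k l r :: nat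
  defines "j \<equiv> k + l" and "N \<equiv> k + l + r"
  assumes p: "p \<noteq> 0" "\<forall>i>0. p ^ i \<noteq> 1" and a: "\<And>i. a * p ^ i \<noteq> 1"
  shows "(1 - a * p ^ (2 * k)) / (1 - a) * qpochhammer a p k * qpochhammer (1 / p ^ N) p k /
      (qpochhammer p p k * qpochhammer (a * p ^ Suc N) p k) * a ^ k * p ^ (k ^ 2) *
      (qbinomial p (l + r) l * qpochhammer (a * p ^ Suc (2 * k + l)) p r *
        qpochhammer (1 / p ^ N) p r / (p ^ N) ^ l) =
    qpochhammer (a * p) p N * qpochhammer (1 / p ^ N) p N *
      (qpochhammer (1 / p ^ N) p j * p ^ j / qpochhammer p p j ^ 2) *
      (qbinomial p j k * (- a) ^ k * p ^ (k ^ 2 + (k choose 2)) *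
        (1 - a * p ^ (2 * k)) / qpochhammer (a * p ^ k) p (Suc j))"
proof -
  define P where "P = (\<lambda>i. qpochhammer p p i)"
  define S where "S = (\<lambda>i. qpochhammer (1 / p ^ N) p i)"
  define \<sigma> where "\<sigma> = p ^ N"
  define A B C D E where "A = qpochhammer a p k" and "B = qpochhammer (a * p ^ k) p (Suc j)"
    and "C = qpochhammer (a * p ^ Suc (2 * k + l)) p r" and "D = qpochhammer (a * p ^ Suc N) p k"
    and "E = qpochhammer (a * p) p N"
  have [simp]: "\<sigma> \<noteq> 0" using p by (simp add: \<sigma>_def)
  have [simp]: "P i \<noteq> 0" for i
    unfolding P_def by (rule qpochhammer_nonzero) (use p(2) in \<open>simp flip: power_Suc\<close>)
  have anz: "qpochhammer (a * p ^ i) p l \<noteq> 0" for i l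
    by (rule qpochhammer_nonzero) (use a in \<open>simp add: mult.assoc flip: power_add\<close>)
  have nz: "1 - a \<noteq> 0" "B \<noteq> 0" "D \<noteq> 0"
    using a[of 0] anz by (simp_all add: B_def D_def del: power_Suc)
  \<comment> \<open>Both sides cut the same product (a;p)_(N+k+1) into consecutive pieces, at
    different places.\<close>
  have ABC: "A * B * C = (1 - a) * E * D"
  proof -
    have "A * B * C = qpochhammer a p (k + (Suc j + r))"
    proof -
      have "a * p ^ k * p ^ Suc j = a * p ^ Suc (2 * k + l)"
      proof -
        have "Suc (2 * k + l) = k + Suc j"
          by (simp add: j_def)
        then show ?thesis
          by (simp only: power_add mult.assoc)
      qed
      then show ?thesis
        unfolding A_def B_def C_def
        by (simp only: qpochhammer_add[of a p k] qpochhammer_add[of _ p "Suc j"] mult.assoc)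
    qed
    also have "k + (Suc j + r) = Suc N + k"
      by (simp add: j_def N_def)
    also have "qpochhammer a p (Suc N + k) = (1 - a) * E * D"
      unfolding qpochhammer_add[of a p "Suc N"] qpochhammer_Suc' E_def D_def ..
    finally show ?thesis .
  qed
  have S: "S i = (-1) ^ i * p ^ (i choose 2) * P N / (P s * \<sigma> ^ i)" if "N = i + s" for i s
  proof -
    have "S i * P s * \<sigma> ^ i = (-1) ^ i * p ^ (i choose 2) * P N"
      using qpochhammer_neg_power[OF p(1), of i s] by (simp add: S_def P_def \<sigma>_def that power_mult)
    then show ?thesis by (simp add: eq_divide_eq mult.assoc)
  qed
  have Sk: "S k = (-1) ^ k * p ^ (k choose 2) * P N / (P (l + r) * \<sigma> ^ k)"
    by (rule S) (simp add: N_def)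
  have Sr: "S r = (-1) ^ r * p ^ (r choose 2) * P N / (P j * \<sigma> ^ r)"
    by (rule S) (simp add: N_def j_def)
  have Sj: "S j = (-1) ^ j * p ^ (j choose 2) * P N / (P r * \<sigma> ^ j)"
    by (rule S) (simp add: N_def j_def)
  have SN: "S N = (-1) ^ N * p ^ (N choose 2) * P N / \<sigma> ^ N"
    using S[of N 0] by (simp add: P_def)
  have key: "\<sigma> ^ j * p ^ (r choose 2) = p ^ (N choose 2) * p ^ (j choose 2) * p ^ j"
  proof -
    have "N * j + (r choose 2) = (N choose 2) + (j choose 2) + j"
      using choose_two_add[of j r] double_choose_two[of j] by (simp add: N_def j_def algebra_simps)
    then show ?thesis
      unfolding \<sigma>_def by (metis power_add power_mult)
  qed
  have sgn: "(-1) ^ k * (-1) ^ r = (-1) ^ N * (-1) ^ j * (-1 :: 'a) ^ k"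
    by (simp add: N_def j_def power_add minus_one_power_iff)
  have sp: "\<sigma> ^ N = \<sigma> ^ k * \<sigma> ^ l * \<sigma> ^ r"
    by (simp add: N_def power_add)
  have main: "S k * S r * P (l + r) / (P r * \<sigma> ^ l) =
      S N * S j * p ^ j * (-1) ^ k * p ^ (k choose 2) / P j"
  proof -
    have "S k * S r * P (l + r) / (P r * \<sigma> ^ l) =
        ((-1) ^ k * (-1) ^ r) * p ^ (k choose 2) * (\<sigma> ^ j * p ^ (r choose 2)) * P N ^ 2 /
        (P j * P r * \<sigma> ^ N * \<sigma> ^ j)"
      unfolding Sk Sr sp by (simp add: field_simps power2_eq_square)
    also have "\<dots> = S N * S j * p ^ j * (-1) ^ k * p ^ (k choose 2) / P j"
      unfolding Sj SN sgn key by (simp add: field_simps power2_eq_square)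
    finally show ?thesis .
  qed
  have ACD: "A * C / ((1 - a) * D) = E / B"
    using ABC nz by (simp add: frac_eq_eq mult_ac)
  have q1: "qbinomial p (l + r) l = P (l + r) / (P l * P r)"
    using qpochhammer_qbinomial[of p l r] by (simp add: P_def[symmetric] eq_divide_eq)
  have q2: "qbinomial p j k = P j / (P k * P l)"
    using qpochhammer_qbinomial[of p k l] by (simp add: P_def[symmetric] j_def eq_divide_eq)
  have "(1 - a * p ^ (2 * k)) / (1 - a) * A * S k / (P k * D) * a ^ k * p ^ (k ^ 2) *
      (P (l + r) / (P l * P r) * C * S r / \<sigma> ^ l) =
    (1 - a * p ^ (2 * k)) * (A * C / ((1 - a) * D)) * a ^ k * p ^ (k ^ 2) *
     (S k * S r * P (l + r) / (P r * \<sigma> ^ l)) / (P k * P l)"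
    by (simp add: mult_ac)
  also have "\<dots> = E * S N * (S j * p ^ j / P j ^ 2) *
      (P j / (P k * P l) * (- a) ^ k * p ^ (k ^ 2 + (k choose 2)) * (1 - a * p ^ (2 * k)) / B)"
    unfolding main ACD by (simp add: power_add power_minus[of a] power2_eq_square mult_ac)
  finally show ?thesis
    unfolding q1 q2 unfolding A_def B_def C_def D_def E_def S_def P_def \<sigma>_def .
qed

text \<open>
  Watson's \<open>\<^sub>8\<phi>\<^sub>7\<close> transformation with two parameters sent to infinity and with the remaining
  free pair \<open>d, e\<close> subject to \<open>d e = a p^(N+1)\<close>; only the symmetric functions of \<open>d, e\<close> enter,
  through \<open>x\<close> and \<open>c\<close>.
\<close>

lemma q_watson_limit:
  fixes a p x c :: "'a::field"
  assumes p: "p \<noteq> 0" "\<forall>i>0. p ^ i \<noteq> 1" and a: "\<And>i. a * p ^ i \<noteq> 1"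
    and c: "c * p ^ N = a * p"
  defines "A \<equiv> \<lambda>k. \<Prod>l<k. 1 - x * p ^ N * p ^ l + c * (p ^ N) ^ 2 * p ^ (2 * l)"
  shows "(\<Sum>k\<le>N. (1 - a * p ^ (2 * k)) / (1 - a) * qpochhammer a p k * qpochhammer (1 / p ^ N) p k /
      (qpochhammer p p k * qpochhammer (a * p ^ Suc N) p k) * a ^ k * p ^ (k ^ 2) *
      A k * (\<Prod>i<N - k. 1 - x * p ^ (k + i) + c * p ^ (2 * (k + i)))) =
    qpochhammer (a * p) p N * qpochhammer (1 / p ^ N) p N *
      (\<Sum>j\<le>N. qpochhammer (1 / p ^ N) p j * p ^ j / qpochhammer p p j ^ 2 * A j)"
proof -
  define \<gamma> where "\<gamma> = (\<lambda>k. (1 - a * p ^ (2 * k)) / (1 - a) * qpochhammer a p k *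
      qpochhammer (1 / p ^ N) p k /
      (qpochhammer p p k * qpochhammer (a * p ^ Suc N) p k) * a ^ k * p ^ (k ^ 2))"
  define \<kappa> where "\<kappa> = (\<lambda>k l. qbinomial p (N - k) l * qpochhammer (a * p ^ Suc (2 * k + l)) p (N - k - l) *
        qpochhammer (1 / p ^ N) p (N - k - l) / (p ^ N) ^ l)"
  define \<delta> where "\<delta> = (\<lambda>j. qpochhammer (1 / p ^ N) p j * p ^ j / qpochhammer p p j ^ 2)"
  define C where "C = qpochhammer (a * p) p N * qpochhammer (1 / p ^ N) p N"
  define F where "F = (\<lambda>j k. qbinomial p j k * (- a) ^ k * p ^ (k ^ 2 + (k choose 2)) *
        (1 - a * p ^ (2 * k)) / qpochhammer (a * p ^ k) p (Suc j))"
  \<comment> \<open>The expansion is applied with \<open>p ^ N\<close> as shift and with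
    \<open>x\<close>, \<open>c\<close> rescaled to start at index \<open>k\<close>. The shifted
    quadratics then continue the product \<open>A k\<close>, and the condition on \<open>c\<close>
    turns the remaining parameter into a power of \<open>p\<close> times \<open>a\<close>.\<close>
  have tail: "A k * (\<Prod>i<N - k. 1 - x * p ^ (k + i) + c * p ^ (2 * (k + i))) =
      (\<Sum>l\<le>N - k. \<kappa> k l * A (k + l))" if "k \<le> N" for k
  proof -
    have "(\<Prod>i<N - k. 1 - x * p ^ (k + i) + c * p ^ (2 * (k + i))) =
        (\<Prod>i<N - k. 1 - (x * p ^ k) * p ^ i + (c * p ^ (2 * k)) * p ^ (2 * i))"
      by (simp add: power_add mult.assoc distrib_left)
    also have "\<dots> = (\<Sum>l\<le>N - k. qbinomial p (N - k) l *
       qpochhammer (c * p ^ (2 * k) * p ^ N * p ^ l) p (N - k - l) *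
       qpochhammer (1 / p ^ N) p (N - k - l) / (p ^ N) ^ l *
       (\<Prod>i<l. 1 - x * p ^ k * p ^ N * p ^ i + c * p ^ (2 * k) * (p ^ N) ^ 2 * p ^ (2 * i)))"
      by (rule q_saalschuetz) (use p in simp)
    also have "\<dots> = (\<Sum>l\<le>N - k. \<kappa> k l *
       (\<Prod>i<l. 1 - x * p ^ N * p ^ (k + i) + c * (p ^ N) ^ 2 * p ^ (2 * (k + i))))"
    proof (intro sum.cong refl)
      fix l
      have "c * p ^ (2 * k) * p ^ N * p ^ l = (c * p ^ N) * (p ^ (2 * k) * p ^ l)"
        by (simp only: mult_ac)
      then have "c * p ^ (2 * k) * p ^ N * p ^ l = a * p ^ Suc (2 * k + l)"
        unfolding c by (simp add: power_add mult_ac)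
      moreover have "(\<Prod>i<l. 1 - x * p ^ k * p ^ N * p ^ i + c * p ^ (2 * k) * (p ^ N) ^ 2 * p ^ (2 * i)) =
          (\<Prod>i<l. 1 - x * p ^ N * p ^ (k + i) + c * (p ^ N) ^ 2 * p ^ (2 * (k + i)))"
        by (intro prod.cong refl) (simp add: power_add distrib_left mult_ac)
      ultimately show "qbinomial p (N - k) l *
         qpochhammer (c * p ^ (2 * k) * p ^ N * p ^ l) p (N - k - l) *
         qpochhammer (1 / p ^ N) p (N - k - l) / (p ^ N) ^ l *
         (\<Prod>i<l. 1 - x * p ^ k * p ^ N * p ^ i + c * p ^ (2 * k) * (p ^ N) ^ 2 * p ^ (2 * i)) =
         \<kappa> k l * (\<Prod>i<l. 1 - x * p ^ N * p ^ (k + i) + c * (p ^ N) ^ 2 * p ^ (2 * (k + i)))"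
        by (simp only: \<kappa>_def)
    qed
    moreover have "A k * (\<Prod>i<l. 1 - x * p ^ N * p ^ (k + i) + c * (p ^ N) ^ 2 * p ^ (2 * (k + i))) =
        A (k + l)" for l
      unfolding A_def by (induction l) (simp_all add: mult.assoc[symmetric])
    ultimately show ?thesis
      by (simp only: sum_distrib_left mult.left_commute[of "A k"])
  qed
  have coeff: "\<gamma> k * \<kappa> k (j - k) = C * \<delta> j * F j k" if "k \<le> j" "j \<le> N" for j k
  proof -
    define l r where "l = j - k" and "r = N - j"
    have e: "j = k + l" "N = k + l + r" "N - k = l + r" "N - k - l = r"
      using that by (simp_all add: l_def r_def)
    show ?thesis
      using q_watson_coefficient[OF p a, of k l r]
      by (simp only: \<gamma>_def \<kappa>_def C_def \<delta>_def F_def l_def[symmetric] e(3,4)) (simp only: e diff_add_inverse)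
  qed
  have "(\<Sum>k\<le>N. \<gamma> k * (A k * (\<Prod>i<N - k. 1 - x * p ^ (k + i) + c * p ^ (2 * (k + i))))) =
      (\<Sum>k\<le>N. \<Sum>l\<le>N - k. \<gamma> k * \<kappa> k l * A (k + l))"
    by (intro sum.cong refl) (simp only: tail sum_distrib_left mult.assoc atMost_iff)
  also have "\<dots> = (\<Sum>(k, l)\<in>{(k, l). k + l \<le> N}. \<gamma> k * \<kappa> k l * A (k + l))"
    unfolding sum.Sigma[OF finite_atMost ballI[OF finite_atMost]]
    by (rule sum.cong) auto
  \<comment> \<open>Collecting by \<open>j = k + l\<close> leaves \<open>A j\<close> outside the
    inner sum, which is then 1 by \<open>q_bailey_unit\<close> up to the factor
    \<open>C * \<delta> j\<close>.\<close>
  also have "\<dots> = (\<Sum>j\<le>N. \<Sum>k\<le>j. \<gamma> k * \<kappa> k (j - k) * A (k + (j - k)))"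
    by (rule sum.triangle_reindex_eq)
  also have "\<dots> = (\<Sum>j\<le>N. C * \<delta> j * A j * (\<Sum>k\<le>j. F j k))"
    by (simp add: coeff sum_distrib_left mult_ac)
  also have "\<dots> = C * (\<Sum>j\<le>N. \<delta> j * A j)"
    using q_bailey_unit[OF a] by (simp add: F_def sum_distrib_left mult.assoc)
  finally show ?thesis
    unfolding \<gamma>_def \<delta>_def C_def by (simp only: mult.assoc)
qed

section \<open>Values and orders of vanishing at a complex number\<close>

lemma rat_to_complex_poly_uminus: "rat_to_complex_poly (- p) = - rat_to_complex_poly p"
  by (intro poly_eqI) (simp add: coeff_map_poly of_rat_minus)

lemma rat_to_complex_poly_power: "rat_to_complex_poly (p ^ n) = rat_to_complex_poly p ^ n"
  by (induction n) (simp_all add: rat_to_complex_poly_mult)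

text \<open>Division with remainder over the rationals stays one over the complex numbers; a nonzero
  remainder has too small a degree to be divisible there.\<close>

lemma rat_to_complex_poly_dvdD:
  assumes "rat_to_complex_poly p dvd rat_to_complex_poly q"
  shows "p dvd q"
proof (cases "p = 0")
  case True
  then show ?thesis using assms rat_to_complex_poly_inj[of q 0] by simp
next
  case False
  have "rat_to_complex_poly q =
      rat_to_complex_poly (q div p) * rat_to_complex_poly p + rat_to_complex_poly (q mod p)"
    by (simp flip: rat_to_complex_poly_mult rat_to_complex_poly_add)
  with assms have dvd: "rat_to_complex_poly p dvd rat_to_complex_poly (q mod p)"
    by (metis dvd_add_right_iff dvd_triv_right)
  have "q mod p = 0"
  proof (rule ccontr)
    assume ne: "q mod p \<noteq> 0"
    then have "rat_to_complex_poly (q mod p) \<noteq> 0"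
      using rat_to_complex_poly_inj[of "q mod p" 0] by simp
    with dvd have "degree p \<le> degree (q mod p)"
      using dvd_imp_degree_le degree_rat_to_complex_poly by metis
    with degree_mod_less[OF False, of q] ne show False
      by simp
  qed
  then show ?thesis by (simp add: dvd_eq_mod_eq_0)
qed

text \<open>A relation between a rational function over Q and a complex number: poles have no value,
  and any representation with a denominator nonzero at \<open>z\<close> may serve, so sums and
  products need no reduction to lowest terms.\<close>

definition has_value :: "complex \<Rightarrow> rat poly fract \<Rightarrow> complex \<Rightarrow> bool" where
  "has_value z x c \<longleftrightarrow> (\<exists>a b. x = to_fract a / to_fract b \<and>
     poly (rat_to_complex_poly b) z \<noteq> 0 \<and>
     poly (rat_to_complex_poly a) z = c * poly (rat_to_complex_poly b) z)"

text \<open>Order of vanishing at least \<open>e\<close>, including the absence of a pole;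
  \<open>e = 0\<close> expresses regularity alone.\<close>

definition vanishes :: "complex \<Rightarrow> nat \<Rightarrow> rat poly fract \<Rightarrow> bool" where
  "vanishes z e x \<longleftrightarrow> (\<exists>a b. x = to_fract a / to_fract b \<and>
     poly (rat_to_complex_poly b) z \<noteq> 0 \<and> [:- z, 1:] ^ e dvd rat_to_complex_poly a)"

lemma has_value_to_fract: "has_value z (to_fract a) (poly (rat_to_complex_poly a) z)"
  unfolding has_value_def by (rule exI[of _ a], rule exI[of _ 1]) simp

lemma has_value_0: "has_value z 0 0" and has_value_1: "has_value z 1 1"
  using has_value_to_fract[of z 0] has_value_to_fract[of z 1] by simp_all

lemma has_value_qvar: "has_value z qvar z"
  using has_value_to_fract[of z "[:0, 1:]"] by (simp add: qvar_def map_poly_pCons)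

lemma has_value_add:
  assumes "has_value z x c" "has_value z y d"
  shows "has_value z (x + y) (c + d)"
proof -
  obtain a b where ab: "x = to_fract a / to_fract b" "poly (rat_to_complex_poly b) z \<noteq> 0"
      "poly (rat_to_complex_poly a) z = c * poly (rat_to_complex_poly b) z"
    using assms(1) unfolding has_value_def by blast
  obtain a' b' where ab': "y = to_fract a' / to_fract b'" "poly (rat_to_complex_poly b') z \<noteq> 0"
      "poly (rat_to_complex_poly a') z = d * poly (rat_to_complex_poly b') z"
    using assms(2) unfolding has_value_def by blast
  have "b \<noteq> 0" "b' \<noteq> 0"
    using ab ab' by auto
  then have "x + y = to_fract (a * b' + a' * b) / to_fract (b * b')"
    using ab ab' by (simp add: add_frac_eq)
  then show ?thesis
    unfolding has_value_def using ab ab'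
    by (intro exI[of _ "a * b' + a' * b"] exI[of _ "b * b'"])
       (simp add: rat_to_complex_poly_add rat_to_complex_poly_mult algebra_simps)
qed

lemma has_value_mult:
  assumes "has_value z x c" "has_value z y d"
  shows "has_value z (x * y) (c * d)"
proof -
  obtain a b where ab: "x = to_fract a / to_fract b" "poly (rat_to_complex_poly b) z \<noteq> 0"
      "poly (rat_to_complex_poly a) z = c * poly (rat_to_complex_poly b) z"
    using assms(1) unfolding has_value_def by blast
  obtain a' b' where ab': "y = to_fract a' / to_fract b'" "poly (rat_to_complex_poly b') z \<noteq> 0"
      "poly (rat_to_complex_poly a') z = d * poly (rat_to_complex_poly b') z"
    using assms(2) unfolding has_value_def by blast
  have "x * y = to_fract (a * a') / to_fract (b * b')"
    using ab ab' by simp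
  then show ?thesis
    unfolding has_value_def using ab ab'
    by (intro exI[of _ "a * a'"] exI[of _ "b * b'"])
       (simp add: rat_to_complex_poly_mult)
qed

lemma has_value_uminus: "has_value z x c \<Longrightarrow> has_value z (- x) (- c)"
  using has_value_mult[OF has_value_to_fract[of z "-1"], of x c]
  by (simp add: rat_to_complex_poly_uminus)

lemma has_value_diff:
  "has_value z x c \<Longrightarrow> has_value z y d \<Longrightarrow> has_value z (x - y) (c - d)"
  using has_value_add[OF _ has_value_uminus, of z x c y d] by simp

lemma has_value_inverse:
  assumes "has_value z x c" "c \<noteq> 0"
  shows "has_value z (1 / x) (1 / c)"
proof -
  obtain a b where ab: "x = to_fract a / to_fract b" "poly (rat_to_complex_poly b) z \<noteq> 0"
      "poly (rat_to_complex_poly a) z = c * poly (rat_to_complex_poly b) z"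
    using assms(1) unfolding has_value_def by blast
  then show ?thesis
    unfolding has_value_def using assms(2)
    by (intro exI[of _ b] exI[of _ a]) simp
qed

lemma has_value_divide:
  "has_value z x c \<Longrightarrow> has_value z y d \<Longrightarrow> d \<noteq> 0 \<Longrightarrow> has_value z (x / y) (c / d)"
  using has_value_mult[OF _ has_value_inverse, of z x c y d] by simp

lemma has_value_power: "has_value z x c \<Longrightarrow> has_value z (x ^ k) (c ^ k)"
  by (induction k) (auto intro: has_value_1 has_value_mult)

lemma has_value_sum:
  "(\<And>i. i \<in> A \<Longrightarrow> has_value z (f i) (g i)) \<Longrightarrow> has_value z (sum f A) (sum g A)"
  by (induction A rule: infinite_finite_induct) (auto intro: has_value_0 has_value_add)

lemma has_value_prod:
  "(\<And>i. i \<in> A \<Longrightarrow> has_value z (f i) (g i)) \<Longrightarrow> has_value z (prod f A) (prod g A)"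
  by (induction A rule: infinite_finite_induct) (auto intro: has_value_1 has_value_mult)

lemma has_value_of_nat: "has_value z (of_nat k) (of_nat k)"
  by (induction k) (auto intro: has_value_0 has_value_1 has_value_add)

lemma has_value_numeral: "has_value z (numeral k) (numeral k)"
  using has_value_of_nat[of z "numeral k"] by simp

lemmas has_value_intros = has_value_0 has_value_1 has_value_qvar has_value_of_nat has_value_numeral
  has_value_add has_value_diff has_value_uminus has_value_mult has_value_power

lemma vanishes_add:
  assumes "vanishes z e x" "vanishes z e y"
  shows "vanishes z e (x + y)"
proof -
  obtain a b where ab: "x = to_fract a / to_fract b" "poly (rat_to_complex_poly b) z \<noteq> 0"
      "[:- z, 1:] ^ e dvd rat_to_complex_poly a"
    using assms(1) unfolding vanishes_def by blast
  obtain a' b' where ab': "y = to_fract a' / to_fract b'" "poly (rat_to_complex_poly b') z \<noteq> 0"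
      "[:- z, 1:] ^ e dvd rat_to_complex_poly a'"
    using assms(2) unfolding vanishes_def by blast
  have "b \<noteq> 0" "b' \<noteq> 0"
    using ab ab' by auto
  then have "x + y = to_fract (a * b' + a' * b) / to_fract (b * b')"
    using ab ab' by (simp add: add_frac_eq)
  then show ?thesis
    unfolding vanishes_def using ab ab'
    by (intro exI[of _ "a * b' + a' * b"] exI[of _ "b * b'"])
       (simp add: rat_to_complex_poly_add rat_to_complex_poly_mult)
qed

lemma vanishes_mult:
  assumes "vanishes z e x" "vanishes z e' y"
  shows "vanishes z (e + e') (x * y)"
proof -
  obtain a b where ab: "x = to_fract a / to_fract b" "poly (rat_to_complex_poly b) z \<noteq> 0"
      "[:- z, 1:] ^ e dvd rat_to_complex_poly a"
    using assms(1) unfolding vanishes_def by blast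
  obtain a' b' where ab': "y = to_fract a' / to_fract b'" "poly (rat_to_complex_poly b') z \<noteq> 0"
      "[:- z, 1:] ^ e' dvd rat_to_complex_poly a'"
    using assms(2) unfolding vanishes_def by blast
  have "x * y = to_fract (a * a') / to_fract (b * b')"
    using ab ab' by simp
  then show ?thesis
    unfolding vanishes_def using ab ab'
    by (intro exI[of _ "a * a'"] exI[of _ "b * b'"])
       (simp add: rat_to_complex_poly_mult power_add mult_dvd_mono)
qed

lemma vanishes_mono: "vanishes z e x \<Longrightarrow> e' \<le> e \<Longrightarrow> vanishes z e' x"
  unfolding vanishes_def using dvd_trans[OF le_imp_power_dvd[of e' e "[:- z, 1:]"]] by blast

lemma vanishes_zero: "vanishes z e 0"
  unfolding vanishes_def by (rule exI[of _ 0], rule exI[of _ 1]) simp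

lemma has_value_imp_regular: "has_value z x c \<Longrightarrow> vanishes z 0 x"
  unfolding vanishes_def has_value_def by auto

lemma has_value_0_imp_vanishes: "has_value z x 0 \<Longrightarrow> vanishes z 1 x"
  unfolding vanishes_def has_value_def by (auto simp: poly_eq_0_iff_dvd)

lemma vanishes_imp_has_value_0: "vanishes z e x \<Longrightarrow> 0 < e \<Longrightarrow> has_value z x 0"
proof -
  assume "vanishes z e x" "0 < e"
  then have "vanishes z 1 x"
    by (auto intro: vanishes_mono)
  then show ?thesis
    unfolding vanishes_def has_value_def by (auto simp: poly_eq_0_iff_dvd)
qed

lemma vanishes_mult_regular: "vanishes z e x \<Longrightarrow> vanishes z 0 y \<Longrightarrow> vanishes z e (x * y)"
  using vanishes_mult[of z e x 0 y] by simp

lemma vanishes_regular_mult: "vanishes z 0 x \<Longrightarrow> vanishes z e y \<Longrightarrow> vanishes z e (x * y)"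
  using vanishes_mult[of z 0 x e y] by simp

lemma vanishes_uminus: "vanishes z e x \<Longrightarrow> vanishes z e (- x)"
  using vanishes_regular_mult[OF has_value_imp_regular[OF has_value_uminus[OF has_value_1]], of z e x]
  by simp

lemma vanishes_diff: "vanishes z e x \<Longrightarrow> vanishes z e y \<Longrightarrow> vanishes z e (x - y)"
  using vanishes_add[OF _ vanishes_uminus, of z e x y] by simp

lemma vanishes_divide:
  "vanishes z e x \<Longrightarrow> has_value z y c \<Longrightarrow> c \<noteq> 0 \<Longrightarrow> vanishes z e (x / y)"
  using vanishes_mult_regular[OF _ has_value_imp_regular[OF has_value_inverse], of z e x y c] by simp

lemma vanishes_sum:
  "(\<And>i. i \<in> A \<Longrightarrow> vanishes z e (f i)) \<Longrightarrow> vanishes z e (sum f A)"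
  by (induction A rule: infinite_finite_induct) (auto intro: vanishes_zero vanishes_add)

lemma vanishes_power: "vanishes z e x \<Longrightarrow> vanishes z (e * k) (x ^ k)"
  by (induction k) (auto intro: vanishes_mult has_value_imp_regular has_value_1)

lemma regular_prod:
  "(\<And>i. i \<in> A \<Longrightarrow> vanishes z 0 (f i)) \<Longrightarrow> vanishes z 0 (prod f A)"
  by (induction A rule: infinite_finite_induct)
    (auto intro: has_value_imp_regular has_value_1 vanishes_mult_regular)

lemma vanishes_prod_diff:
  assumes "\<And>i. i \<in> A \<Longrightarrow> vanishes z e (f i - g i)"
    and "\<And>i. i \<in> A \<Longrightarrow> vanishes z 0 (f i)" and "\<And>i. i \<in> A \<Longrightarrow> vanishes z 0 (g i)"
  shows "vanishes z e (prod f A - prod g A)"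
  using assms
proof (induction A rule: infinite_finite_induct)
  case (insert i A)
  have "prod f (insert i A) - prod g (insert i A) =
      (f i - g i) * prod f A + g i * (prod f A - prod g A)"
    using insert.hyps by (simp add: algebra_simps)
  moreover have "vanishes z e ((f i - g i) * prod f A)"
    using insert.prems by (intro vanishes_mult_regular regular_prod) auto
  moreover have "vanishes z e (g i * (prod f A - prod g A))"
    using insert by (intro vanishes_regular_mult) auto
  ultimately show ?case
    using vanishes_add by simp
qed (auto intro: vanishes_zero)

lemma vanishes_imp_dvd_numerator:
  assumes "vanishes z e x"
  shows "[:- z, 1:] ^ e dvd rat_to_complex_poly (fst (quot_of_fract x))"
proof -
  obtain a b where ab: "x = to_fract a / to_fract b" "poly (rat_to_complex_poly b) z \<noteq> 0"
      "[:- z, 1:] ^ e dvd rat_to_complex_poly a"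
    using assms unfolding vanishes_def by blast
  define f s where "f = fst (quot_of_fract x)" and "s = snd (quot_of_fract x)"
  have "b \<noteq> 0" "s \<noteq> 0"
    using ab by (auto simp: s_def)
  moreover have "to_fract f / to_fract s = to_fract a / to_fract b"
    using Fract_quot_of_fract[of x] ab(1) by (simp add: f_def s_def Fract_conv_to_fract)
  ultimately have "to_fract (f * b) = to_fract (a * s)"
    by (simp add: frac_eq_eq)
  then have "f * b = a * s"
    by (simp only: to_fract_eq_iff)
  then have "rat_to_complex_poly f * rat_to_complex_poly b =
      rat_to_complex_poly a * rat_to_complex_poly s"
    by (simp flip: rat_to_complex_poly_mult)
  then have "[:- z, 1:] ^ e dvd rat_to_complex_poly f * rat_to_complex_poly b"
    using ab(3) by simp
  moreover have "coprime ([:- z, 1:] ^ e) (rat_to_complex_poly b)"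
  proof -
    have "prime_elem [:- z, 1:]"
      by (rule prime_elem_linear_field_poly) simp
    moreover have "\<not> [:- z, 1:] dvd rat_to_complex_poly b"
      using ab(2) by (simp add: poly_eq_0_iff_dvd)
    ultimately show ?thesis
      using prime_elem_imp_power_coprime coprime_commute by blast
  qed
  ultimately show ?thesis
    unfolding f_def by (simp add: coprime_dvd_mult_left_iff)
qed

section \<open>From local orders to divisibility by the modulus\<close>

lemma prod_linear_power_dvd:
  fixes p :: "complex poly"
  assumes "finite S" "\<And>z. z \<in> S \<Longrightarrow> [:- z, 1:] ^ e z dvd p"
  shows "(\<Prod>z\<in>S. [:- z, 1:] ^ e z) dvd p"
  using assms
proof (induction S)
  case (insert z S)
  have "coprime [:- w, 1:] [:- z, 1:]" if "w \<in> S" for w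
  proof (rule coprimeI)
    fix c assume "c dvd [:- w, 1:]" "c dvd [:- z, 1:]"
    then have "c dvd [:- w, 1:] - [:- z, 1:]"
      by (rule dvd_diff)
    moreover have "is_unit ([:- w, 1:] - [:- z, 1:])"
      using that insert.hyps by (auto simp: is_unit_pCons_iff)
    ultimately show "is_unit c"
      using dvd_trans by blast
  qed
  then have "coprime (\<Prod>w\<in>S. [:- w, 1:] ^ e w) ([:- z, 1:] ^ e z)"
    by (intro prod_coprime_left) simp
  then have "(\<Prod>w\<in>S. [:- w, 1:] ^ e w) * [:- z, 1:] ^ e z dvd p"
    using insert by (intro divides_mult) auto
  then show ?case
    using insert.hyps by (simp add: mult.commute)
qed simp

text \<open>Over the complex numbers [n] has the n-th roots of unity other than 1 as simple roots,
  and the cube of the cyclotomic polynomial adds three at the primitive ones: multiplicity 4 there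
  and 1 elsewhere.\<close>

lemma fract_cong_if_vanishes:
  assumes n: "n > 1"
    and "\<And>z. z \<in> primitive_roots_unity n \<Longrightarrow> vanishes z 4 (A - B)"
    and "\<And>d z. d dvd n \<Longrightarrow> 1 < d \<Longrightarrow> d < n \<Longrightarrow> z \<in> primitive_roots_unity d \<Longrightarrow> vanishes z 1 (A - B)"
  shows "fract_cong A B (qint [:0, 1:] n * cyclotomic n ^ 3)"
proof -
  define R where "R = {z::complex. z ^ n = 1}"
  define e where "e = (\<lambda>z. if z \<in> primitive_roots_unity n then 4 else 1 :: nat)"
  have fin: "finite R"
    using n by (simp add: R_def finite_roots_unity)
  have q1: "[:0, 1:] \<noteq> (1 :: rat poly)" by (simp add: one_pCons)
  let ?X = "[:0, 1:] :: complex poly"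
  have "rat_to_complex_poly ((1 - [:0, 1:]) * qint [:0, 1:] n) = rat_to_complex_poly (1 + - ([:0, 1:] ^ n))"
    unfolding qint_eq_sum[OF q1] one_diff_power_eq[symmetric] by simp
  moreover have "rat_to_complex_poly (1 - [:0, 1:]) = - [:- 1, 1:]"
    by (simp add: one_pCons map_poly_pCons)
  ultimately have "- [:- 1, 1:] * rat_to_complex_poly (qint [:0, 1:] n) = 1 - ?X ^ n"
    by (simp only: rat_to_complex_poly_mult rat_to_complex_poly_add rat_to_complex_poly_uminus
        rat_to_complex_poly_power) (simp add: map_poly_pCons)
  then have "- (- [:- 1, 1:] * rat_to_complex_poly (qint [:0, 1:] n)) = - (1 - ?X ^ n)"
    by (simp only:)
  then have "[:- 1, 1:] * rat_to_complex_poly (qint [:0, 1:] n) = monom 1 n - 1"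
    unfolding mult_minus_left minus_minus minus_diff_eq by (simp add: monom_altdef)
  also have "\<dots> = (\<Prod>z\<in>R. [:- z, 1:])"
    using poly_roots_unity[of n] n by (simp add: R_def)
  also have "\<dots> = [:- 1, 1:] * (\<Prod>z\<in>R - {1}. [:- z, 1:])"
    using prod.remove[OF fin, of 1 "\<lambda>z. [:- z, 1:]"] by (simp add: R_def)
  finally have qint: "rat_to_complex_poly (qint [:0, 1:] n) = (\<Prod>z\<in>R - {1}. [:- z, 1:])"
    by (metis mult_cancel_left pCons_eq_0_iff one_neq_zero)
  have sub: "primitive_roots_unity n \<subseteq> R - {1}"
    using n by (auto simp: primitive_roots_unity_def R_def)
  have "rat_to_complex_poly (cyclotomic n ^ 3) = (\<Prod>z\<in>primitive_roots_unity n. [:- z, 1:] ^ 3)"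
    using n by (simp add: rat_to_complex_poly_power map_poly_cyclotomic prod_power_distrib)
  also have "\<dots> = (\<Prod>z\<in>R - {1}. if z \<in> primitive_roots_unity n then [:- z, 1:] ^ 3 else 1)"
    using fin sub by (simp add: prod.inter_restrict[symmetric] Int_absorb1)
  finally have cyc: "rat_to_complex_poly (cyclotomic n ^ 3) =
      (\<Prod>z\<in>R - {1}. if z \<in> primitive_roots_unity n then [:- z, 1:] ^ 3 else 1)" .
  have "rat_to_complex_poly (qint [:0, 1:] n * cyclotomic n ^ 3) = (\<Prod>z\<in>R - {1}. [:- z, 1:] ^ e z)"
    unfolding rat_to_complex_poly_mult qint cyc prod.distrib[symmetric]
    by (intro prod.cong refl) (auto simp: e_def numeral_eq_Suc)
  moreover have "(\<Prod>z\<in>R - {1}. [:- z, 1:] ^ e z) dvd rat_to_complex_poly (fst (quot_of_fract (A - B)))"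
  proof (rule prod_linear_power_dvd)
    fix z assume z: "z \<in> R - {1}"
    have "vanishes z (e z) (A - B)"
    proof (cases "z \<in> primitive_roots_unity n")
      case True
      then show ?thesis using assms(2) by (simp add: e_def)
    next
      case False
      obtain d where d: "d dvd n" "z \<in> primitive_roots_unity d"
        using roots_unity_eq_Union[of n] n z by (auto simp: R_def)
      have "d \<noteq> n" "d \<noteq> 1" "d \<noteq> 0"
        using d False z n by (auto simp: primitive_roots_unity_def)
      moreover have "d \<le> n"
        using d n by (intro dvd_imp_le) auto
      ultimately show ?thesis
        using assms(3)[of d z] d False by (simp add: e_def)
    qed
    then show "[:- z, 1:] ^ e z dvd rat_to_complex_poly (fst (quot_of_fract (A - B)))"
      by (rule vanishes_imp_dvd_numerator)
  qed (use fin in simp)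
  ultimately show ?thesis
    unfolding fract_cong_def by (intro rat_to_complex_poly_dvdD) (simp only:)
qed

section \<open>The summands at a root of unity\<close>

lemma primitive_root_power_eq_1_iff:
  assumes "z \<in> primitive_roots_unity n" "n > 0"
  shows "z ^ j = 1 \<longleftrightarrow> n dvd j"
proof
  assume j: "z ^ j = 1"
  have z: "z ^ n = 1" "\<And>m. 0 < m \<Longrightarrow> m < n \<Longrightarrow> z ^ m \<noteq> 1"
    using assms by (auto simp: primitive_roots_unity_def)
  have "z ^ (n * (j div n) + j mod n) = z ^ (j mod n)"
    unfolding power_add power_mult using z by simp
  then have "z ^ (j mod n) = 1"
    using j by simp
  then have "j mod n = 0"
    using z(2)[of "j mod n"] assms(2) by fastforce
  then show "n dvd j"
    by auto
next
  assume "n dvd j"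
  then show "z ^ j = 1"
    using assms by (auto simp: primitive_roots_unity_def power_mult elim!: dvdE)
qed

definition qratio :: "'a::field \<Rightarrow> nat \<Rightarrow> 'a" where
  "qratio q k = (\<Prod>i<k. (1 - q ^ (2 * i + 1)) / (1 - q ^ (2 * i + 2)))"

definition qterm :: "'a::field \<Rightarrow> nat \<Rightarrow> 'a" where
  "qterm q k = (1 - q ^ (4 * k + 1)) / (1 - q) * qratio q k ^ 4 * q ^ (2 * k ^ 2 + k)"

text \<open>Minus the logarithmic derivative in \<delta>, at \<delta> = 0, of the product of the
  quotients ((1 - s)^3 - s \<delta>) / ((1 - t)^3 + t^2 \<delta>), where s and t run through the odd
  and even powers.\<close>

definition cubic_sum :: "'a::field \<Rightarrow> nat \<Rightarrow> 'a" where
  "cubic_sum z k = (\<Sum>i<k. z ^ (2 * i + 1) / (1 - z ^ (2 * i + 1)) ^ 3 +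
     (z ^ (2 * i + 2)) ^ 2 / (1 - z ^ (2 * i + 2)) ^ 3)"

text \<open>Exchanges, up to sign, the odd and the even terms of \<open>cubic_sum\<close>: at an
  n-th root of unity with n odd, complementary exponents have opposite parity.\<close>

lemma cubic_inverse:
  fixes s t :: "'a::field"
  assumes "s * t = 1" "s \<noteq> 1"
  shows "t / (1 - t) ^ 3 = - (s ^ 2 / (1 - s) ^ 3)"
proof -
  have "s \<noteq> 0"
    using assms by auto
  then have "t = 1 / s"
    using assms by (simp add: eq_divide_eq mult.commute)
  have "(1 - t) ^ 3 = - ((1 - s) ^ 3 / s ^ 3)"
    unfolding \<open>t = 1 / s\<close> using \<open>s \<noteq> 0\<close> by (simp add: field_simps power3_eq_cube)
  then show ?thesis
    unfolding \<open>t = 1 / s\<close> using \<open>s \<noteq> 0\<close> by (simp add: power3_eq_cube power2_eq_square)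
qed

lemma qratio_Suc:
  "qratio q (Suc k) = qratio q k * ((1 - q ^ (2 * k + 1)) / (1 - q ^ (2 * k + 2)))"
  by (simp add: qratio_def)

context
  fixes z :: complex and m n :: nat
  assumes z: "z \<in> primitive_roots_unity n" and n: "n = 2 * m + 1"
begin

lemma root_nonzero: "z \<noteq> 0"
  using z n by (auto simp: primitive_roots_unity_def)

lemma root_power_neq_1: "0 < j \<Longrightarrow> j < n \<Longrightarrow> z ^ j \<noteq> 1"
  using z by (auto simp: primitive_roots_unity_def)

lemma root_power_complement:
  assumes "i + j = n"
  shows "z ^ i * z ^ j = 1"
  using assms z by (simp add: primitive_roots_unity_def flip: power_add)

text \<open>The exponents of the \<open>k\<close>-th factor and of the factor mirrored to it add up
  crosswise to \<open>n\<close>, so the numerator base of one is the inverse of the denominator base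
  of the other. Inverting both bases changes the quotient of factors only by a power of
  \<open>z\<close>.\<close>

lemma qratio_reflect: "k \<le> m \<Longrightarrow> qratio z (m - k) = qratio z m * qratio z k * z ^ k"
proof (induction k)
  case 0
  then show ?case by (simp add: qratio_def)
next
  case (Suc k)
  define r where "r = m - Suc k"
  have r: "m = Suc (r + k)"
    using Suc.prems by (simp add: r_def)
  define s t s' t' where "s = z ^ (2 * k + 1)" and "t = z ^ (2 * k + 2)"
    and "s' = z ^ (2 * r + 1)" and "t' = z ^ (2 * r + 2)"
  have "s \<noteq> 1" "t \<noteq> 1" "s' \<noteq> 1" "t' \<noteq> 1"
    unfolding s_def t_def s'_def t'_def by (rule root_power_neq_1; use r n in simp)+
  have "t * s' = 1" "s * t' = 1"
    unfolding s_def t_def s'_def t'_def by (rule root_power_complement, use r n in simp)+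
  have t: "t = s * z"
    by (simp add: s_def t_def)
  have "s \<noteq> 0"
    using root_nonzero by (simp add: s_def)
  have s't': "s' = 1 / (s * z)" "t' = 1 / s"
    using \<open>t * s' = 1\<close> \<open>s * t' = 1\<close> \<open>t = s * z\<close> \<open>s \<noteq> 0\<close> root_nonzero by (simp_all add: field_simps)
  have ratio: "(1 - s') / (1 - t') * z * (1 - s) = 1 - t"
    using \<open>t' \<noteq> 1\<close> \<open>s \<noteq> 1\<close> \<open>s \<noteq> 0\<close> root_nonzero
    unfolding s't' t by (simp add: divide_simps) (simp add: algebra_simps)
  have "m - k = Suc r"
    using r by simp
  then have "qratio z r * ((1 - s') / (1 - t')) = qratio z m * qratio z k * z ^ k"
    using Suc.IH r by (simp only: s'_def t'_def qratio_Suc)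
  then have "qratio z r * ((1 - s') / (1 - t')) * (z * (1 - s)) =
      qratio z m * qratio z k * z ^ k * (z * (1 - s))"
    by (simp only:)
  then have "qratio z r * ((1 - s') / (1 - t') * z * (1 - s)) =
      qratio z m * qratio z k * z ^ k * z * (1 - s)"
    by (simp only: mult.assoc)
  then have "qratio z r * (1 - t) = qratio z m * qratio z k * z ^ k * z * (1 - s)"
    unfolding ratio .
  then have "qratio z r = qratio z m * (qratio z k * ((1 - s) / (1 - t))) * z ^ Suc k"
    using \<open>t \<noteq> 1\<close> by (simp add: field_simps)
  then show ?case
    by (simp add: r_def[symmetric] qratio_Suc s_def t_def)
qed

text \<open>The case \<open>k = m\<close> of the reflection determines the square of the constant
  \<open>qratio z m\<close>, and thus the fourth power, in which it enters the summands.\<close>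

lemma qratio_half_power4: "qratio z m ^ 4 = z"
proof -
  have "qratio z m * qratio z m * z ^ m = 1"
    using qratio_reflect[of m] by (simp add: qratio_def)
  then have "qratio z m ^ 4 * (z ^ m * z ^ m) = 1 * 1"
    by (metis (no_types) mult.assoc mult.left_commute power4_eq_xxxx)
  moreover have "z ^ m * z ^ m * z = 1"
    using root_power_complement[of "m + m" 1] n by (simp add: power_add)
  ultimately show ?thesis
    by (metis mult.assoc mult.commute mult_1_left)
qed

text \<open>With \<open>r = m - k\<close> the exponents \<open>2 * r ^ 2 + r\<close> and
  \<open>2 * k ^ 2 + k\<close> differ by \<open>n * (r - k)\<close>, so these powers agree. The sign
  comes from the linear factor, because \<open>4 * r + 1\<close> and \<open>4 * k + 1\<close> add up
  to \<open>2 * n\<close>.\<close>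

lemma qterm_reflect:
  assumes "k \<le> m"
  shows "qterm z (m - k) = - qterm z k"
proof -
  define r where "r = m - k"
  have r: "m = r + k"
    using assms by (simp add: r_def)
  have "qratio z r ^ 4 = z * qratio z k ^ 4 * z ^ (4 * k)"
    using qratio_reflect[OF assms] by (simp add: r_def power_mult_distrib qratio_half_power4 power_mult mult.commute)
  moreover have "z ^ (2 * r ^ 2 + r) = z ^ (2 * k ^ 2 + k)"
  proof -
    have "2 * r ^ 2 + r + n * k = 2 * k ^ 2 + k + n * r"
      by (simp add: n r power2_eq_square algebra_simps)
    then have "z ^ (2 * r ^ 2 + r) * (z ^ n) ^ k = z ^ (2 * k ^ 2 + k) * (z ^ n) ^ r"
      by (simp only: power_add[symmetric] power_mult[symmetric])
    then show ?thesis
      using z by (simp add: primitive_roots_unity_def)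
  qed
  moreover have factor: "z * z ^ (4 * k) * (1 - z ^ (4 * r + 1)) = - (1 - z ^ (4 * k + 1))"
  proof -
    have "z * z ^ (4 * k) * z ^ (4 * r + 1) = z ^ n * z ^ n"
      by (simp add: n r flip: power_add power_Suc) (simp add: algebra_simps)
    then show ?thesis
      using z by (simp add: primitive_roots_unity_def right_diff_distrib)
  qed
  ultimately have "qterm z r = (1 - z ^ (4 * r + 1)) / (1 - z) * (z * qratio z k ^ 4 * z ^ (4 * k)) *
       z ^ (2 * k ^ 2 + k)"
    by (simp only: qterm_def)
  also have "\<dots> = (z * z ^ (4 * k) * (1 - z ^ (4 * r + 1))) / (1 - z) * qratio z k ^ 4 *
       z ^ (2 * k ^ 2 + k)"
    by (simp only: times_divide_eq_left times_divide_eq_right mult_ac)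
  also have "\<dots> = - qterm z k"
    unfolding factor by (simp only: qterm_def minus_divide_left[symmetric] mult_minus_left)
  finally show ?thesis
    by (simp add: r_def)
qed

lemma qterm_weighted_sum_eq_0:
  assumes "\<And>k. k \<le> m \<Longrightarrow> w (m - k) = w k"
  shows "(\<Sum>k\<le>m. qterm z k * w k) = 0"
proof -
  have "(\<Sum>k\<le>m. qterm z k * w k) = (\<Sum>k\<le>m. qterm z (m - k) * w (m - k))"
    using sum.nat_diff_reindex[of "\<lambda>k. qterm z k * w k" "Suc m"] by (simp add: lessThan_Suc_atMost)
  also have "\<dots> = (\<Sum>k\<le>m. - (qterm z k * w k))"
    by (intro sum.cong refl) (simp add: assms qterm_reflect)
  finally show ?thesis
    by (simp add: sum_negf)
qed

text \<open>The factor \<open>i = m\<close> has numerator \<open>1 - z ^ n\<close>. For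
  \<open>k < n\<close> no denominator vanishes at \<open>z\<close>, so this is a true value and not
  the result of a division by 0.\<close>

lemma qratio_eq_0:
  assumes "m < k"
  shows "qratio z k = 0"
proof -
  have "1 - z ^ (2 * m + 1) = 0"
    using z by (simp add: primitive_roots_unity_def n)
  then show ?thesis
    using assms unfolding qratio_def by (intro prod_zero) auto
qed

lemma cubic_sum_add: "k \<le> m \<Longrightarrow> cubic_sum z (m - k) = cubic_sum z m + cubic_sum z k"
proof (induction k)
  case 0
  then show ?case by (simp add: cubic_sum_def)
next
  case (Suc k)
  define r where "r = m - Suc k"
  have r: "m = Suc (r + k)"
    using Suc.prems by (simp add: r_def)
  define s t s' t' where "s = z ^ (2 * k + 1)" and "t = z ^ (2 * k + 2)"
    and "s' = z ^ (2 * r + 1)" and "t' = z ^ (2 * r + 2)"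
  have ne: "t \<noteq> 1" "t' \<noteq> 1"
    unfolding t_def t'_def by (rule root_power_neq_1; use r n in simp)+
  have eq: "t * s' = 1" "t' * s = 1"
    unfolding s_def t_def s'_def t'_def by (rule root_power_complement, use r n in simp)+
  have Suc_eq: "cubic_sum z (Suc k) = cubic_sum z k + (s / (1 - s) ^ 3 + t ^ 2 / (1 - t) ^ 3)"
    "cubic_sum z (Suc r) = cubic_sum z r + (s' / (1 - s') ^ 3 + t' ^ 2 / (1 - t') ^ 3)"
    by (simp_all add: cubic_sum_def s_def t_def s'_def t'_def)
  have "cubic_sum z (Suc r) = cubic_sum z m + cubic_sum z k"
    using Suc.IH r by simp
  then show ?case
    unfolding Suc_eq cubic_inverse[OF eq(1) ne(1)] r_def[symmetric]
      cubic_inverse[OF eq(2) ne(2)] by (simp add: algebra_simps)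
qed

text \<open>For \<open>k = m\<close> the additive relation reads
  \<open>0 = 2 * cubic_sum z m\<close>, so its constant disappears.\<close>

lemma cubic_sum_reflect: "k \<le> m \<Longrightarrow> cubic_sum z (m - k) = cubic_sum z k"
  using cubic_sum_add[of k] cubic_sum_add[of m] by (simp add: cubic_sum_def[of _ 0])

end

section \<open>The sum of t / (1 - t)^2 over powers of a root of unity\<close>

lemma sum_by_parts:
  fixes t :: "'a::comm_ring_1"
  shows "(1 - t) * (\<Sum>k<N. f k * t ^ k) = f 0 + t * (\<Sum>k<N. (f (Suc k) - f k) * t ^ k) - f N * t ^ N"
proof (induction N)
  case (Suc N)
  then show ?case
    unfolding sum.lessThan_Suc distrib_left[of "1 - t"] by (simp add: algebra_simps)
qed simp

text \<open>A finite Fourier expansion of t / (1 - t)^2. The weight k (n - k) vanishes at both ends,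
  so the first summation by parts has no boundary terms; the second leaves only boundary terms and a
  geometric sum equal to 0.\<close>

lemma root_quadratic_sum:
  fixes t :: "'a::field"
  assumes "t ^ n = 1" "t \<noteq> 1"
  shows "(1 - t) ^ 2 * (\<Sum>k<n. of_nat k * (of_nat n - of_nat k) * t ^ k) = 2 * of_nat n * t"
proof -
  have geo: "(\<Sum>k<n. t ^ k) = 0"
    using one_diff_power_eq[of t n] assms by simp
  have 1: "(1 - t) * (\<Sum>k<n. of_nat k * (of_nat n - of_nat k) * t ^ k) =
      t * (\<Sum>k<n. (of_nat n - 1 - 2 * of_nat k) * t ^ k)"
    by (subst sum_by_parts) (simp add: algebra_simps)
  have 2: "(1 - t) * (\<Sum>k<n. (of_nat n - 1 - 2 * of_nat k) * t ^ k) = 2 * of_nat n"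
    by (subst sum_by_parts)
       (simp add: assms geo algebra_simps sum_negf flip: sum_distrib_left sum_distrib_right)
  have "(1 - t) ^ 2 * (\<Sum>k<n. of_nat k * (of_nat n - of_nat k) * t ^ k) =
      (1 - t) * ((1 - t) * (\<Sum>k<n. of_nat k * (of_nat n - of_nat k) * t ^ k))"
    by (simp only: power2_eq_square mult.assoc)
  also have "\<dots> = t * ((1 - t) * (\<Sum>k<n. (of_nat n - 1 - 2 * of_nat k) * t ^ k))"
    unfolding 1 by (rule mult.left_commute)
  finally show ?thesis
    unfolding 2 by (simp add: mult_ac)
qed

lemma sum_mult_complement:
  "6 * (\<Sum>k<N. of_nat k * (x - of_nat k)) =
    3 * x * of_nat N * (of_nat N - 1) - (of_nat N - 1) * of_nat N * (2 * of_nat N - (1 :: 'a::comm_ring_1))"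
  by (induction N) (simp_all add: algebra_simps)

lemma sum_odd_even: "(\<Sum>i<2 * m. f (Suc i)) = (\<Sum>j<m. f (2 * j + 1) + f (2 * j + 2))"
  for f :: "nat \<Rightarrow> 'a::comm_monoid_add"
  by (induction m) (simp_all add: add.assoc)

text \<open>Over all nontrivial powers of \<open>z\<close> the Fourier expansion reduces the sum to
  that of k (n - k), which gives - (n^2 - 1) / 12. The map t -> 1/t preserves t / (1 - t)^2 and
  matches odd with even exponents, so the even ones contribute half.\<close>

lemma sum_root_inverse_squares:
  assumes z: "z \<in> primitive_roots_unity n" and n: "n = 2 * m + 1"
  shows "(\<Sum>i<m. z ^ (2 * i + 2) / (1 - z ^ (2 * i + 2)) ^ 2) = - ((of_nat n ^ 2 - 1) / 24)"
proof -
  define h where "h = (\<lambda>i. z ^ i / (1 - z ^ i) ^ 2)"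
  have zn: "z ^ n = 1" and ne: "\<And>i. 0 < i \<Longrightarrow> i < n \<Longrightarrow> z ^ i \<noteq> 1"
    using z by (auto simp: primitive_roots_unity_def)
  have h: "2 * of_nat n * h i = (\<Sum>k<n. of_nat k * (of_nat n - of_nat k) * z ^ (i * k))"
    if "0 < i" "i < n" for i
  proof -
    have "(z ^ i) ^ n = 1"
      using zn by (metis mult.commute power_mult power_one)
    from root_quadratic_sum[OF this ne[OF that]]
    have "2 * of_nat n * z ^ i =
        (1 - z ^ i) ^ 2 * (\<Sum>k<n. of_nat k * (of_nat n - of_nat k) * z ^ (i * k))"
      by (simp only: power_mult)
    then show ?thesis
      using ne[OF that] by (simp add: h_def divide_eq_eq mult.commute)
  qed
  have geo: "(\<Sum>i<2 * m. z ^ (Suc i * k)) = - 1" if "0 < k" "k < n" for k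
  proof -
    have "(1 - z ^ k) * (\<Sum>i<n. (z ^ k) ^ i) = 1 - (z ^ k) ^ n"
      by (rule one_diff_power_eq[symmetric])
    also have "(z ^ k) ^ n = 1"
      using zn by (metis mult.commute power_mult power_one)
    finally have "(\<Sum>i<n. (z ^ k) ^ i) = 0"
      using ne[OF that] by simp
    then have "1 + (\<Sum>i<2 * m. (z ^ k) ^ Suc i) = 0"
      unfolding n Suc_eq_plus1[symmetric] sum.lessThan_Suc_shift by simp
    then show ?thesis
      by (simp add: mult.commute[of _ k] power_mult eq_neg_iff_add_eq_0 add.commute del: power_Suc mult_Suc_right mult_Suc)
  qed
  have "2 * of_nat n * (\<Sum>i<2 * m. h (Suc i)) =
      (\<Sum>i<2 * m. \<Sum>k<n. of_nat k * (of_nat n - of_nat k) * z ^ (Suc i * k))"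
    unfolding sum_distrib_left by (intro sum.cong refl h) (use n in auto)
  also have "\<dots> = (\<Sum>k<n. of_nat k * (of_nat n - of_nat k) * (\<Sum>i<2 * m. z ^ (Suc i * k)))"
    unfolding sum_distrib_left by (rule sum.swap)
  also have "\<dots> = (\<Sum>k<n. - (of_nat k * (of_nat n - of_nat k)))"
  proof (intro sum.cong refl)
    fix k assume "k \<in> {..<n}"
    then show "of_nat k * (of_nat n - of_nat k) * (\<Sum>i<2 * m. z ^ (Suc i * k)) =
        - (of_nat k * (of_nat n - of_nat k))"
      using geo[of k] by (cases "k = 0") auto
  qed
  finally have "2 * of_nat n * (\<Sum>i<2 * m. h (Suc i)) = - (\<Sum>k<n. of_nat k * (of_nat n - of_nat k))"
    by (simp add: sum_negf)
  moreover have "6 * (\<Sum>k<n. of_nat k * (of_nat n - of_nat k)) = of_nat n * (of_nat n ^ 2 - (1 :: complex))"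
    unfolding sum_mult_complement by (simp add: algebra_simps power2_eq_square)
  moreover have "of_nat n * (12 * (\<Sum>i<2 * m. h (Suc i))) = 6 * (2 * of_nat n * (\<Sum>i<2 * m. h (Suc i)))"
    by simp
  ultimately have "of_nat n * (12 * (\<Sum>i<2 * m. h (Suc i))) = of_nat n * - (of_nat n ^ 2 - (1 :: complex))"
    by (simp only: mult_minus_right)
  moreover have "of_nat n \<noteq> (0 :: complex)"
    unfolding of_nat_eq_0_iff using n by simp
  ultimately have total: "12 * (\<Sum>i<2 * m. h (Suc i)) = - (of_nat n ^ 2 - 1)"
    using mult_left_cancel by blast
  have refl_h: "h (2 * (m - Suc j) + 1) = h (2 * j + 2)" if "j < m" for j
  proof -
    define s t where "s = z ^ (2 * (m - Suc j) + 1)" and "t = z ^ (2 * j + 2)"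
    have "s * t = z ^ n"
      unfolding s_def t_def power_add[symmetric] using that n by (intro arg_cong[of _ _ "power z"]) simp
    then have "t \<noteq> 0" "s = 1 / t"
      using zn by (auto simp: eq_divide_eq)
    moreover have "t \<noteq> 1"
      unfolding t_def by (rule ne) (use that n in auto)
    moreover have "(1 - 1 / t) ^ 2 = (1 - t) ^ 2 / t ^ 2"
      using \<open>t \<noteq> 0\<close> by (simp add: field_simps power2_eq_square)
    ultimately have "s / (1 - s) ^ 2 = t / (1 - t) ^ 2"
      by (simp add: power2_eq_square)
    then show ?thesis
      by (simp only: h_def s_def t_def)
  qed
  have "(\<Sum>j<m. h (2 * j + 1)) = (\<Sum>j<m. h (2 * (m - Suc j) + 1))"
    by (rule sum.nat_diff_reindex[symmetric])
  also have "\<dots> = (\<Sum>j<m. h (2 * j + 2))"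
    by (intro sum.cong refl refl_h) simp
  finally have "24 * (\<Sum>j<m. h (2 * j + 2)) = - (of_nat n ^ 2 - 1)"
    using total unfolding sum_odd_even sum.distrib by simp
  then show ?thesis
    unfolding h_def by (simp add: field_simps)
qed

section \<open>Regularity and vanishing of the truncated sums\<close>

lemma qvar_power_neq_1: "i > 0 \<Longrightarrow> qvar ^ i \<noteq> 1"
proof
  assume i: "i > 0" and "qvar ^ i = 1"
  then have "to_fract ([:0, 1 :: rat:] ^ i) = to_fract 1"
    by (simp add: qvar_def to_fract_power)
  then have "monom (1 :: rat) i = 1"
    by (simp only: to_fract_eq_iff) (simp add: monom_altdef)
  then show False
    using i by (metis degree_1 degree_monom_eq one_neq_zero neq0_conv)
qed

lemma qvar_nonzero: "qvar \<noteq> 0"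
  by (simp add: qvar_def)

lemma has_value_nonzero: "has_value z x c \<Longrightarrow> c \<noteq> 0 \<Longrightarrow> x \<noteq> 0"
  unfolding has_value_def by auto

section \<open>The factorial quotient through central Gaussian binomials\<close>

lemma qpochhammer_odd: "qpochhammer q (q ^ 2) k = (\<Prod>i<k. 1 - q ^ (2 * i + 1))"
  by (simp add: qpochhammer_def power_mult)

lemma qpochhammer_even: "qpochhammer (q ^ 2) (q ^ 2) k = (\<Prod>i<k. 1 - q ^ (2 * i + 2))"
proof -
  have "q ^ 2 * (q ^ 2) ^ i = q ^ (2 * i + 2)" for i
    unfolding power_add power_mult by (rule mult.commute)
  then show ?thesis
    by (simp only: qpochhammer_def)
qed

lemma qratio_qpochhammer: "qratio q k = qpochhammer q (q ^ 2) k / qpochhammer (q ^ 2) (q ^ 2) k"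
  by (simp add: qratio_def qpochhammer_odd qpochhammer_even prod_dividef)

lemma qpochhammer_double:
  "qpochhammer q q (2 * k) = qpochhammer q (q ^ 2) k * qpochhammer (q ^ 2) (q ^ 2) k"
proof (induction k)
  case (Suc k)
  have "qpochhammer q q (2 * Suc k) =
      qpochhammer q q (2 * k) * (1 - q ^ (2 * k + 1)) * (1 - q ^ (2 * k + 2))"
    by (simp add: qpochhammer_Suc)
  then show ?case
    unfolding Suc.IH by (simp add: qpochhammer_odd qpochhammer_even mult_ac)
qed simp

lemma qpochhammer_square:
  "qpochhammer (q ^ 2) (q ^ 2) k = qpochhammer q q k * (\<Prod>i<k. 1 + q ^ (i + 1))"
proof -
  have "1 - q ^ (2 * i + 2) = (1 - q ^ (i + 1)) * (1 + q ^ (i + 1))" for i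
  proof -
    have "2 * i + 2 = (i + 1) + (i + 1)"
      by simp
    then have "q ^ (2 * i + 2) = q ^ (i + 1) * q ^ (i + 1)"
      by (simp only: power_add)
    then show ?thesis
      by (simp only:) (simp add: algebra_simps)
  qed
  moreover have "qpochhammer q q k = (\<Prod>i<k. 1 - q ^ (i + 1))"
    by (simp add: qpochhammer_def)
  ultimately show ?thesis
    unfolding qpochhammer_even by (simp only: prod.distrib)
qed

text \<open>A form without the factors 1 - q^i that vanish at roots of unity in both numerator and
  denominator; only the factors 1 + q^i remain to be inverted.\<close>

lemma qratio_qbinomial:
  fixes q :: "'a::field"
  assumes "\<And>i. i > 0 \<Longrightarrow> q ^ i \<noteq> 1"
  shows "qratio q k = qbinomial q (2 * k) k / (\<Prod>i<k. 1 + q ^ (i + 1)) ^ 2"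
proof -
  have nz: "qpochhammer q q k \<noteq> 0" "qpochhammer (q ^ 2) (q ^ 2) k \<noteq> 0"
    using assms[of "Suc _"] assms[of "2 * _ + 2"]
    by (auto intro!: qpochhammer_nonzero simp: qpochhammer_even simp flip: power_Suc)
  have "qratio q k = qpochhammer q q (2 * k) / qpochhammer (q ^ 2) (q ^ 2) k ^ 2"
    using nz by (simp add: qratio_qpochhammer qpochhammer_double power2_eq_square)
  also have "qpochhammer q q (2 * k) = qbinomial q (2 * k) k * qpochhammer q q k ^ 2"
    using qpochhammer_qbinomial[of q k k] by (simp add: mult_2 power2_eq_square)
  finally show ?thesis
    using nz by (simp add: qpochhammer_square power_mult_distrib)
qed

lemma has_value_qbinomial: "has_value z x c \<Longrightarrow> has_value z (qbinomial x n k) (qbinomial c n k)"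
  by (induction c n k rule: qbinomial.induct)
     (auto simp del: power_Suc intro: has_value_intros)

context
  fixes z :: complex and m n :: nat
  assumes z: "z \<in> primitive_roots_unity n" and n: "n = 2 * m + 1"
begin

lemma root_even_power_neq_1:
  assumes "0 < i" "i < n"
  shows "z ^ (2 * i) \<noteq> 1"
proof
  assume "z ^ (2 * i) = 1"
  then have "n dvd 2 * i"
    using primitive_root_power_eq_1_iff[OF z] n by simp
  moreover have "coprime n 2"
    using n by simp
  ultimately have "n dvd i"
    by (simp add: coprime_dvd_mult_right_iff)
  then show False
    using assms by (auto dest: dvd_imp_le)
qed

text \<open>The order of \<open>z\<close> is odd, so -1 is not a power of \<open>z\<close> and the
  denominators of \<open>qratio_qbinomial\<close> are nonzero at \<open>z\<close> for every
  \<open>k\<close>.\<close>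

lemma regular_qratio: "vanishes z 0 (qratio qvar k)"
proof -
  have "1 + z ^ j \<noteq> 0" for j
  proof
    assume "1 + z ^ j = 0"
    then have zj: "z ^ j = - 1"
      by (simp add: eq_neg_iff_add_eq_0 add.commute)
    then have "(z ^ j) ^ n = - 1"
      using n by simp
    moreover have "(z ^ j) ^ n = 1"
    proof -
      have "(z ^ j) ^ n = (z ^ n) ^ j"
        by (simp only: power_mult[symmetric] mult.commute)
      then show ?thesis
        using z by (simp add: primitive_roots_unity_def)
    qed
    ultimately show False
      by simp
  qed
  then have "(\<Prod>i<k. 1 + z ^ (i + 1)) ^ 2 \<noteq> 0"
    by (simp del: power_Suc)
  then have "has_value z (qratio qvar k) (qbinomial z (2 * k) k / (\<Prod>i<k. 1 + z ^ (i + 1)) ^ 2)"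
    using qratio_qbinomial[of qvar k] qvar_power_neq_1
    by (auto intro!: has_value_divide has_value_qbinomial has_value_power has_value_prod has_value_intros)
  then show ?thesis
    by (rule has_value_imp_regular)
qed

section \<open>Blocks of summands at a root of unity\<close>

lemma has_value_qratio_block:
  assumes "j < n"
  shows "has_value z (\<Prod>i<j. (1 - qvar ^ (2 * (l * n + i) + 1)) / (1 - qvar ^ (2 * (l * n + i) + 2)))
    (qratio z j)"
  unfolding qratio_def
proof (rule has_value_prod)
  fix i assume i: "i \<in> {..<j}"
  have zn: "z ^ n = 1"
    using z by (simp add: primitive_roots_unity_def)
  have e: "z ^ (2 * (l * n + i) + r) = z ^ (2 * i + r)" for r
  proof -
    have "2 * (l * n + i) + r = n * (2 * l) + (2 * i + r)"
      by (simp add: algebra_simps)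
    then show ?thesis
      by (simp only: power_add power_mult[of z n] zn power_one mult_1_left)
  qed
  have "z ^ (2 * i + 2) \<noteq> 1"
    using root_even_power_neq_1[of "i + 1"] i assms by simp
  then show "has_value z ((1 - qvar ^ (2 * (l * n + i) + 1)) / (1 - qvar ^ (2 * (l * n + i) + 2)))
      ((1 - z ^ (2 * i + 1)) / (1 - z ^ (2 * i + 2)))"
    unfolding e[symmetric] by (intro has_value_divide has_value_intros) simp
qed

lemma has_value_qratio: "j < n \<Longrightarrow> has_value z (qratio qvar j) (qratio z j)"
  using has_value_qratio_block[of j 0] by (simp add: qratio_def)

text \<open>Exponents within a block reduce modulo \<open>n\<close> to those of the initial block.
  The factor accumulated before the block is common to its summands and stays a rational function:
  regularity is all that is asked of it.\<close>

lemma has_value_qterm_block: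
  assumes "j < n" "m > 0"
  obtains x where "qterm qvar (l * n + j) = qratio qvar (l * n) ^ 4 * x" "has_value z x (qterm z j)"
proof
  define \<rho> where "\<rho> = (\<Prod>i<j. (1 - qvar ^ (2 * (l * n + i) + 1)) / (1 - qvar ^ (2 * (l * n + i) + 2)))"
  define x where "x = (1 - qvar ^ (4 * (l * n + j) + 1)) / (1 - qvar) * \<rho> ^ 4 *
      qvar ^ (2 * (l * n + j) ^ 2 + (l * n + j))"
  have "qratio qvar (l * n + j) = qratio qvar (l * n) * \<rho>"
    unfolding \<rho>_def by (induction j) (simp_all add: qratio_Suc mult.assoc)
  then show "qterm qvar (l * n + j) = qratio qvar (l * n) ^ 4 * x"
    by (simp add: qterm_def x_def power_mult_distrib)
  have zn: "z ^ n = 1"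
    using z by (simp add: primitive_roots_unity_def)
  have e: "z ^ (n * a + b) = z ^ b" for a b
    by (simp only: power_add power_mult[of z n] zn power_one mult_1_left)
  have e1: "4 * (l * n + j) + 1 = n * (4 * l) + (4 * j + 1)"
    by (simp add: algebra_simps)
  have e2: "2 * (l * n + j) ^ 2 + (l * n + j) = n * (2 * l * l * n + 4 * l * j + l) + (2 * j ^ 2 + j)"
    by (simp add: algebra_simps power2_eq_square)
  have "z \<noteq> 1"
    using root_power_neq_1[OF z n, of 1] n assms by simp
  then have "has_value z x ((1 - z ^ (4 * (l * n + j) + 1)) / (1 - z) * qratio z j ^ 4 *
      z ^ (2 * (l * n + j) ^ 2 + (l * n + j)))"
    unfolding x_def \<rho>_def
    by (intro has_value_mult has_value_divide has_value_power has_value_qratio_block assms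
          has_value_diff has_value_1 has_value_qvar) simp
  then show "has_value z x (qterm z j)"
    unfolding qterm_def e1 e2 e .
qed

text \<open>The values at \<open>z\<close> beyond \<open>m\<close> are 0, so the full block and its
  first half have the same value, the antisymmetric sum.\<close>

lemma vanishes_qterm_block:
  assumes "m > 0" and "J = n \<or> J = Suc m"
  shows "vanishes z 1 (\<Sum>j<J. qterm qvar (l * n + j))"
proof -
  have "\<forall>j. \<exists>x. j < n \<longrightarrow> qterm qvar (l * n + j) = qratio qvar (l * n) ^ 4 * x \<and> has_value z x (qterm z j)"
    using has_value_qterm_block[OF _ assms(1)] by metis
  then obtain x where x: "\<And>j. j < n \<Longrightarrow> qterm qvar (l * n + j) = qratio qvar (l * n) ^ 4 * x j"
      "\<And>j. j < n \<Longrightarrow> has_value z (x j) (qterm z j)"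
    by metis
  have J: "J \<le> n"
    using assms n by auto
  have "(\<Sum>j<J. qterm z j) = (\<Sum>j\<le>m. qterm z j)"
    using assms n
    by (intro sum.mono_neutral_right) (auto simp: qterm_def qratio_eq_0[OF z n])
  also have "\<dots> = 0"
    using qterm_weighted_sum_eq_0[OF z n, of "\<lambda>_. 1"] by simp
  finally have "has_value z (\<Sum>j<J. x j) 0"
    using has_value_sum[of "{..<J}" z x "qterm z"] x(2) J by simp
  then have "vanishes z 1 (qratio qvar (l * n) ^ 4 * (\<Sum>j<J. x j))"
    using vanishes_power[OF regular_qratio, of 4 "l * n"]
    by (intro vanishes_regular_mult has_value_0_imp_vanishes) simp_all
  also have "qratio qvar (l * n) ^ 4 * (\<Sum>j<J. x j) = (\<Sum>j<J. qterm qvar (l * n + j))"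
    unfolding sum_distrib_left by (intro sum.cong refl) (use x(1) J in auto)
  finally show ?thesis .
qed

lemma vanishes_qterm_sum:
  assumes "m > 0" and "J = 0 \<or> J = Suc m"
  shows "vanishes z 1 (\<Sum>k<L * n + J. qterm qvar k)"
proof -
  have blocks: "(\<Sum>k<l * n + J. qterm qvar k) = (\<Sum>k<l * n. qterm qvar k) + (\<Sum>j<J. qterm qvar (l * n + j))" for l J
    by (induction J) (simp_all add: add.assoc)
  have "vanishes z 1 (\<Sum>k<L * n. qterm qvar k)"
  proof (induction L)
    case (Suc L)
    have "Suc L * n = L * n + n"
      by simp
    then show ?case
      unfolding blocks[of L n, symmetric] using Suc vanishes_qterm_block[OF assms(1), of n L]
      by (simp only: blocks) (auto intro: vanishes_add)
  qed (simp add: vanishes_zero)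
  moreover have "vanishes z 1 (\<Sum>j<J. qterm qvar (L * n + j))"
    using assms(2) vanishes_qterm_block[OF assms(1), of J L] by (auto simp: vanishes_zero)
  ultimately show ?thesis
    unfolding blocks by (rule vanishes_add)
qed

end

text \<open>Serves twice: with \<delta>, of order three, for the weights of the perturbed sum, and
  with (1 - y)^2, of order two, for the correction factor.\<close>

lemma vanishes_prod_first_order:
  fixes k :: nat
  assumes "vanishes z e x" "\<And>i. i < k \<Longrightarrow> vanishes z 0 (h i)"
  shows "vanishes z (2 * e) ((\<Prod>i<k. 1 + x * h i) - (1 + x * (\<Sum>i<k. h i)))"
  using assms(2)
proof (induction k)
  case (Suc k)
  define P S where "P = (\<Prod>i<k. 1 + x * h i)" and "S = (\<Sum>i<k. h i)"
  have "vanishes z 0 (1 + x * h k)"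
    using Suc.prems[of k] vanishes_mono[OF assms(1)]
    by (intro vanishes_add vanishes_mult_regular has_value_imp_regular[OF has_value_1]) auto
  then have "vanishes z (2 * e) ((P - (1 + x * S)) * (1 + x * h k))"
    using Suc by (intro vanishes_mult_regular) (auto simp: P_def S_def)
  moreover have "vanishes z (2 * e) (x * x * (S * h k))"
  proof (rule vanishes_mult_regular)
    show "vanishes z (2 * e) (x * x)"
      using vanishes_mult[OF assms(1) assms(1)] by (simp add: mult_2)
    show "vanishes z 0 (S * h k)"
      using Suc.prems by (auto simp: S_def intro!: vanishes_mult_regular vanishes_sum)
  qed
  moreover have "(\<Prod>i<Suc k. 1 + x * h i) - (1 + x * (\<Sum>i<Suc k. h i)) =
      (P - (1 + x * S)) * (1 + x * h k) + x * x * (S * h k)"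
    by (simp add: P_def S_def algebra_simps)
  ultimately show ?case
    using vanishes_add by metis
qed (simp add: vanishes_zero)

section \<open>The perturbed sum\<close>

text \<open>Reversing the first two products expresses all three through t = q^(2 i + 2). The
  identity (t - y) (1 - y t) = t (1 - y)^2 - y (1 - t)^2 then isolates the deviation from (1 - t)^3.
  The leftover powers y / t^2 multiply to 1 / q^m, the power q^((1 - n)/2) of the
  congruence.\<close>

lemma prod_quadratic_factors:
  fixes q :: "'a::field" and m :: nat
  defines "y \<equiv> q ^ (2 * m + 1)"
  assumes q: "q \<noteq> 0" "\<And>i. i > 0 \<Longrightarrow> q ^ i \<noteq> 1"
  shows "qpochhammer q (q ^ 2) m * qpochhammer (1 / (q ^ 2) ^ m) (q ^ 2) m *
      qpochhammer (q * (q ^ 2) ^ Suc m) (q ^ 2) m =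
    1 / q ^ m * (\<Prod>i<m. 1 - (1 - y) ^ 2 * q ^ (2 * i + 2) / (y * (1 - q ^ (2 * i + 2)) ^ 2)) *
    (\<Prod>i<m. 1 - q ^ (2 * i + 2)) ^ 3"
proof -
  define t where "t = (\<lambda>i. q ^ (2 * i + 2))"
  have y0: "y \<noteq> 0" and t0: "t i \<noteq> 0" and t1: "t i \<noteq> 1" for i
    using q q(2)[of "2 * i + 2"] by (simp_all add: y_def t_def)
  have 1: "qpochhammer q (q ^ 2) m = (\<Prod>i<m. 1 - y / t i)"
  proof -
    have "qpochhammer q (q ^ 2) m = (\<Prod>i<m. 1 - q ^ (2 * (m - Suc i) + 1))"
      unfolding qpochhammer_odd by (rule prod.nat_diff_reindex[symmetric])
    also have "\<dots> = (\<Prod>i<m. 1 - y / t i)"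
    proof (intro prod.cong refl)
      fix i assume "i \<in> {..<m}"
      then have "2 * (m - Suc i) + 1 + (2 * i + 2) = 2 * m + 1"
        by auto
      then have "q ^ (2 * (m - Suc i) + 1) * t i = y"
        unfolding t_def y_def by (simp only: power_add[symmetric])
      then have "q ^ (2 * (m - Suc i) + 1) = y / t i"
        unfolding nonzero_eq_divide_eq[OF t0] .
      then show "1 - q ^ (2 * (m - Suc i) + 1) = 1 - y / t i"
        by (simp only:)
    qed
    finally show ?thesis .
  qed
  have 2: "qpochhammer (1 / (q ^ 2) ^ m) (q ^ 2) m = (\<Prod>i<m. 1 - 1 / t i)"
  proof -
    have "qpochhammer (1 / (q ^ 2) ^ m) (q ^ 2) m = (\<Prod>i<m. 1 - 1 / (q ^ 2) ^ m * (q ^ 2) ^ (m - Suc i))"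
      unfolding qpochhammer_def by (rule prod.nat_diff_reindex[symmetric])
    also have "\<dots> = (\<Prod>i<m. 1 - 1 / t i)"
    proof (intro prod.cong refl)
      fix i assume "i \<in> {..<m}"
      then have "2 * (m - Suc i) + (2 * i + 2) = 2 * m"
        by auto
      then have "(q ^ 2) ^ (m - Suc i) * t i = (q ^ 2) ^ m"
        unfolding t_def by (simp only: power_add[symmetric] power_mult[symmetric])
      then have "1 / (q ^ 2) ^ m * (q ^ 2) ^ (m - Suc i) = 1 / t i"
        using t0[of i] q by (simp add: divide_eq_eq eq_divide_eq)
      then show "1 - 1 / (q ^ 2) ^ m * (q ^ 2) ^ (m - Suc i) = 1 - 1 / t i"
        by (simp only:)
    qed
    finally show ?thesis .
  qed
  have 3: "qpochhammer (q * (q ^ 2) ^ Suc m) (q ^ 2) m = (\<Prod>i<m. 1 - y * t i)"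
  proof -
    have "q * (q ^ 2) ^ Suc m * (q ^ 2) ^ i = y * t i" for i
    proof -
      have "q * (q ^ 2) ^ Suc m * (q ^ 2) ^ i = q ^ (1 + 2 * Suc m + 2 * i)"
        by (simp only: power_add power_mult power_one_right)
      also have "1 + 2 * Suc m + 2 * i = (2 * m + 1) + (2 * i + 2)"
        by simp
      finally show ?thesis
        by (simp only: y_def t_def power_add)
    qed
    then show ?thesis
      by (simp only: qpochhammer_def)
  qed
  have factor: "(1 - y / t i) * (1 - 1 / t i) * (1 - y * t i) =
      y / t i ^ 2 * (1 - (1 - y) ^ 2 * t i / (y * (1 - t i) ^ 2)) * (1 - t i) ^ 3" for i
  proof -
    define u where "u = 1 - t i"
    have t: "t i = 1 - u" and u: "u \<noteq> 0" "1 - u \<noteq> 0"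
      using t1[of i] t0[of i] by (simp_all add: u_def)
    have "(1 - y / t i) * (1 - 1 / t i) * (1 - y * t i) * t i ^ 2 =
        - u * ((t i - y) * (1 - y * t i))"
      using t0[of i] by (simp add: u_def power2_eq_square field_simps)
    also have "\<dots> = u * (y * u ^ 2 - (1 - y) ^ 2 * t i)"
      unfolding t by (simp add: algebra_simps power2_eq_square)
    also have "\<dots> = y * (1 - (1 - y) ^ 2 * t i / (y * u ^ 2)) * u ^ 3"
      using u y0 by (simp add: field_simps power3_eq_cube power2_eq_square)
    finally show ?thesis
      using t0[of i] by (simp add: u_def eq_divide_eq)
  qed
  have "(\<Prod>i<k. t i) = q ^ (k * (k + 1))" for k
  proof (induction k)
    case (Suc k)
    have "Suc k * (Suc k + 1) = k * (k + 1) + (2 * k + 2)"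
      by simp
    then show ?case
      using Suc by (simp only: prod.lessThan_Suc t_def power_add)
  qed simp
  moreover have "m * (m + 1) * 2 = (2 * m + 1) * m + m"
    by (simp add: algebra_simps)
  ultimately have "(\<Prod>i<m. t i) ^ 2 = y ^ m * q ^ m"
    by (simp only: y_def power_mult[symmetric] power_add[symmetric])
  moreover have "(\<Prod>i<m. y / t i ^ 2) = y ^ m / (\<Prod>i<m. t i) ^ 2"
    by (simp add: prod_dividef prod_power_distrib)
  ultimately have "(\<Prod>i<m. y / t i ^ 2) = 1 / q ^ m"
    using y0 q by simp
  then show ?thesis
    unfolding 1 2 3 prod.distrib[symmetric] factor
    unfolding prod.distrib prod_power_distrib[symmetric] t_def by simp
qed

text \<open>The transformation with base q^2, \<open>a = q\<close> and \<open>N = m\<close>.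
  \<open>N i\<close> and \<open>D i\<close> are the products of 1 - s u and of 1 - t / u over the
  three values of u, for s = q^(2 i + 1) and t = q^(2 i + 2), in expanded form.\<close>

lemma watson_half:
  fixes q :: "'a::field" and m :: nat
  defines "n \<equiv> 2 * m + 1"
  defines "y \<equiv> q ^ n"
  defines "\<delta> \<equiv> (1 - y) ^ 3 / y"
  defines "N \<equiv> \<lambda>i. (1 - q ^ (2 * i + 1)) ^ 3 - q ^ (2 * i + 1) * \<delta>"
    and "D \<equiv> \<lambda>i. (1 - q ^ (2 * i + 2)) ^ 3 + (q ^ (2 * i + 2)) ^ 2 * \<delta>"
  assumes q: "q \<noteq> 0" "\<And>i. i > 0 \<Longrightarrow> q ^ i \<noteq> 1" and D0: "\<And>i. i < m \<Longrightarrow> D i \<noteq> 0"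
  shows "(\<Sum>k\<le>m. (1 - q ^ (4 * k + 1)) / (1 - q) * qratio q k * (prod N {..<k} / prod D {..<k}) *
      q ^ (2 * k ^ 2 + k)) =
    (1 - y) / (1 - q) * (1 / q ^ m *
    (\<Prod>i<m. 1 - (1 - y) ^ 2 * q ^ (2 * i + 2) / (y * (1 - q ^ (2 * i + 2)) ^ 2)) *
    ((\<Prod>i<m. 1 - q ^ (2 * i + 2)) ^ 3 / prod D {..<m}) *
    (\<Sum>j\<le>m. prod N {..<j} * q ^ (2 * j) / (\<Prod>i<j. 1 - q ^ (2 * i + 2)) ^ 2))"
proof -
  define p where "p = q ^ 2"
  define \<sigma> where "\<sigma> = p ^ m"
  \<comment> \<open>\<open>x\<close> and \<open>c\<close> are the sum and the product of q u /
    \<sigma> over the two roots u of u^2 - (3 y - y^2) u + y, simplified by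
    \<open>y = q * \<sigma>\<close>.\<close>
  define x where "x = q ^ 2 * (3 - y)"
  define c where "c = q ^ 4 / y"
  define Y where "Y = (\<lambda>i. 1 - x * p ^ i + c * p ^ (2 * i))"
  define A where "A = (\<lambda>k. \<Prod>l<k. 1 - x * \<sigma> * p ^ l + c * \<sigma> ^ 2 * p ^ (2 * l))"
  define U where "U = (\<lambda>k. qpochhammer (1 / \<sigma>) p k)"
  define V where "V = (\<lambda>k. qpochhammer (q * p ^ Suc m) p k)"
  define E where "E = (\<lambda>k. qpochhammer p p k)"
  define B where "B = (\<lambda>k. prod Y {..<k})"
  have \<sigma>0: "\<sigma> \<noteq> 0"
    using q by (simp add: \<sigma>_def p_def)
  have y: "y = q * \<sigma>"
    by (simp add: y_def n_def \<sigma>_def p_def power_mult)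
  have P2: "p ^ (2 * i) = p ^ i * p ^ i" for i
    by (simp only: mult_2 power_add)
  have c': "c = q ^ 3 / \<sigma>"
    using q by (simp add: c_def y power_numeral_reduce)
  have q1: "q ^ (2 * i + 1) = q * p ^ i" and q2: "q ^ (2 * i + 2) = q ^ 2 * p ^ i" for i
    unfolding p_def power_add power_mult power_one_right by (rule mult.commute)+
  \<comment> \<open>The first factor belongs to u = 1/y, as q^(2 i + 1) / y = p^i / \<sigma>; the
    quadratic collects the other two values.\<close>
  have NF: "N i = (1 - 1 / \<sigma> * p ^ i) * (1 - x * \<sigma> * p ^ i + c * \<sigma> ^ 2 * p ^ (2 * i))" for i
  proof -
    define P where "P = p ^ i"
    have "\<sigma> * ((1 - q * P) ^ 3 - q * P * ((1 - q * \<sigma>) ^ 3 / (q * \<sigma>))) =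
        \<sigma> * (1 - q * P) ^ 3 - P * (1 - q * \<sigma>) ^ 3"
      using \<sigma>0 q(1) by (simp add: field_simps)
    also have "\<dots> = (\<sigma> - P) * (1 - q ^ 2 * (3 - q * \<sigma>) * \<sigma> * P + q ^ 3 * \<sigma> * (P * P))"
      by (simp add: algebra_simps power3_eq_cube power2_eq_square)
    also have "\<dots> = \<sigma> * ((1 - 1 / \<sigma> * P) * (1 - q ^ 2 * (3 - q * \<sigma>) * \<sigma> * P + q ^ 3 / \<sigma> * \<sigma> ^ 2 * (P * P)))"
    proof -
      have "\<sigma> - P = \<sigma> * (1 - 1 / \<sigma> * P)" "q ^ 3 / \<sigma> * \<sigma> ^ 2 = q ^ 3 * \<sigma>"
        using \<sigma>0 by (simp_all add: field_simps power2_eq_square)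
      then show ?thesis
        by (simp only: mult.assoc)
    qed
    finally have eq: "(1 - q * P) ^ 3 - q * P * ((1 - q * \<sigma>) ^ 3 / (q * \<sigma>)) =
        (1 - 1 / \<sigma> * P) * (1 - q ^ 2 * (3 - q * \<sigma>) * \<sigma> * P + q ^ 3 / \<sigma> * \<sigma> ^ 2 * (P * P))"
      using \<sigma>0 by (simp only: mult_left_cancel[OF \<sigma>0])
    show ?thesis
      unfolding N_def q1 P2 \<delta>_def c' x_def y eq[unfolded P_def] ..
  qed
  have DF: "D i = Y i * (1 - q * p ^ Suc m * p ^ i)" for i
  proof -
    define P where "P = p ^ i"
    have "\<sigma> * ((1 - q ^ 2 * P) ^ 3 + (q ^ 2 * P) ^ 2 * ((1 - q * \<sigma>) ^ 3 / (q * \<sigma>))) =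
        \<sigma> * (1 - q ^ 2 * P) ^ 3 + q ^ 3 * P ^ 2 * (1 - q * \<sigma>) ^ 3"
      using \<sigma>0 q(1) by (simp add: field_simps power2_eq_square power3_eq_cube)
    also have "\<dots> = (\<sigma> - q ^ 2 * (3 - q * \<sigma>) * \<sigma> * P + q ^ 3 * (P * P)) * (1 - q * (q ^ 2 * \<sigma>) * P)"
      by (simp add: algebra_simps power3_eq_cube power2_eq_square)
    also have "\<sigma> - q ^ 2 * (3 - q * \<sigma>) * \<sigma> * P + q ^ 3 * (P * P) =
        \<sigma> * (1 - q ^ 2 * (3 - q * \<sigma>) * P + q ^ 3 / \<sigma> * (P * P))"
      using \<sigma>0 by (simp add: field_simps)
    finally have "\<sigma> * D i = \<sigma> * (Y i * (1 - q * p ^ Suc m * p ^ i))"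
      unfolding D_def Y_def q2 P2 \<delta>_def c' x_def y P_def
      by (simp only: power_Suc \<sigma>_def[symmetric] p_def[symmetric] mult.assoc)
    then show ?thesis
      using \<sigma>0 by simp
  qed
  have NP: "prod N {..<k} = U k * A k" for k
    by (simp add: NF U_def A_def qpochhammer_def prod.distrib)
  have DP: "prod D {..<k} = B k * V k" for k
    by (simp add: DF V_def B_def qpochhammer_def prod.distrib)
  have BV0: "B k \<noteq> 0" "V k \<noteq> 0" if "k \<le> m" for k
  proof -
    have "prod D {..<k} \<noteq> 0"
      using D0 that by auto
    then show "B k \<noteq> 0" "V k \<noteq> 0"
      by (auto simp: DP)
  qed
  have B_split: "B k * (\<Prod>i<m - k. Y (k + i)) = B m" if "k \<le> m" for k
  proof -
    have "B (k + l) = B k * (\<Prod>i<l. Y (k + i))" for l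
      by (induction l) (simp_all add: B_def mult.assoc)
    from this[of "m - k"] show ?thesis
      using that by simp
  qed
  have EE: "E k = (\<Prod>i<k. 1 - q ^ (2 * i + 2))" for k
    by (simp add: E_def p_def qpochhammer_even)
  have E0: "E k \<noteq> 0" for k
    using q(2)[of "2 * _ + 2"] by (auto simp: EE)
  define L where "L = (\<lambda>k. (1 - q ^ (4 * k + 1)) / (1 - q) * qratio q k * (prod N {..<k} / prod D {..<k}) *
      q ^ (2 * k ^ 2 + k))"
  define S where "S = (\<Sum>j\<le>m. prod N {..<j} * q ^ (2 * j) / E j ^ 2)"
  have "(\<Sum>k\<le>m. (1 - q * p ^ (2 * k)) / (1 - q) * qpochhammer q p k * U k / (E k * V k) * q ^ k * p ^ (k ^ 2) *
      A k * (\<Prod>i<m - k. Y (k + i))) =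
      qpochhammer (q * p) p m * U m * (\<Sum>j\<le>m. U j * p ^ j / E j ^ 2 * A j)"
    unfolding U_def V_def E_def A_def Y_def \<sigma>_def
  proof (rule q_watson_limit)
    show "p \<noteq> 0" "\<forall>i>0. p ^ i \<noteq> 1"
      using q by (simp_all add: p_def flip: power_mult)
    show "q * p ^ i \<noteq> 1" for i
      using q(2)[of "2 * i + 1"] by (simp only: q1) simp
    \<comment> \<open>The balancing condition; it holds because the three values of u have product
      1.\<close>
    show "c * p ^ m = q * p"
      using \<sigma>0 by (simp add: c' \<sigma>_def[symmetric]) (simp add: p_def power2_eq_square power3_eq_cube)
  qed
  also have "(\<Sum>k\<le>m. (1 - q * p ^ (2 * k)) / (1 - q) * qpochhammer q p k * U k / (E k * V k) * q ^ k * p ^ (k ^ 2) *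
      A k * (\<Prod>i<m - k. Y (k + i))) = (\<Sum>k\<le>m. B m * L k)"
  proof (intro sum.cong refl)
    fix k assume "k \<in> {..m}"
    then have k: "k \<le> m" by simp
    have "q * p ^ (2 * k) = q ^ (4 * k + 1)"
      unfolding p_def power_mult[symmetric] by simp
    moreover have "q ^ k * p ^ (k ^ 2) = q ^ (2 * k ^ 2 + k)"
      by (simp add: p_def power_add flip: power_mult)
    moreover have "qratio q k = qpochhammer q p k / E k"
      by (simp add: qratio_qpochhammer p_def E_def)
    ultimately have "B m * L k = (1 - q * p ^ (2 * k)) / (1 - q) * (qpochhammer q p k / E k) *
        (U k * A k / (B k * V k)) * (q ^ k * p ^ (k ^ 2)) * (B k * (\<Prod>i<m - k. Y (k + i)))"
      unfolding L_def NP DP B_split[OF k] by (simp only: mult.commute)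
    also have "\<dots> = (1 - q * p ^ (2 * k)) / (1 - q) * qpochhammer q p k * U k / (E k * V k) * q ^ k * p ^ (k ^ 2) *
      A k * (\<Prod>i<m - k. Y (k + i))"
      using BV0[OF k] by (simp add: mult_ac)
    finally show "(1 - q * p ^ (2 * k)) / (1 - q) * qpochhammer q p k * U k / (E k * V k) * q ^ k * p ^ (k ^ 2) *
      A k * (\<Prod>i<m - k. Y (k + i)) = B m * L k"
      by (rule sym)
  qed
  also have "(\<Sum>j\<le>m. U j * p ^ j / E j ^ 2 * A j) = S"
  proof -
    have "p ^ j = q ^ (2 * j)" for j
      by (simp only: p_def power_mult)
    then show ?thesis
      unfolding S_def NP by (intro sum.cong refl) (simp add: mult_ac)
  qed
  finally have main: "B m * sum L {..m} = qpochhammer (q * p) p m * U m * S"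
    by (simp only: sum_distrib_left)
  have "(1 - q) * qpochhammer (q * p) p m = qpochhammer q p m * (1 - y)"
    by (simp only: qpochhammer_Suc'[symmetric] qpochhammer_Suc y \<sigma>_def)
  moreover have "1 - q \<noteq> 0"
    using q(2)[of 1] by simp
  ultimately have shift: "qpochhammer (q * p) p m = (1 - y) / (1 - q) * qpochhammer q p m"
    by (simp add: field_simps)
  have "prod D {..<m} * sum L {..m} = (1 - y) / (1 - q) * ((qpochhammer q p m * U m * V m) * S)"
  proof -
    have "prod D {..<m} * sum L {..m} = (B m * sum L {..m}) * V m"
      unfolding DP by (simp only: mult_ac)
    then show ?thesis
      unfolding main shift by (simp only: mult_ac)
  qed
  also have "qpochhammer q p m * U m * V m = 1 / q ^ m *
      (\<Prod>i<m. 1 - (1 - y) ^ 2 * q ^ (2 * i + 2) / (y * (1 - q ^ (2 * i + 2)) ^ 2)) * E m ^ 3"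
    unfolding U_def V_def \<sigma>_def p_def EE y_def n_def by (rule prod_quadratic_factors[OF q])
  finally have eq: "prod D {..<m} * sum L {..m} = (1 - y) / (1 - q) * (1 / q ^ m *
      (\<Prod>i<m. 1 - (1 - y) ^ 2 * q ^ (2 * i + 2) / (y * (1 - q ^ (2 * i + 2)) ^ 2)) * E m ^ 3 * S)" .
  have "sum L {..m} = prod D {..<m} * sum L {..m} / prod D {..<m}"
    using BV0[of m] by (simp add: DP)
  then have "sum L {..m} = (1 - y) / (1 - q) * (1 / q ^ m *
      (\<Prod>i<m. 1 - (1 - y) ^ 2 * q ^ (2 * i + 2) / (y * (1 - q ^ (2 * i + 2)) ^ 2)) * E m ^ 3 * S) /
      prod D {..<m}"
    unfolding eq .
  then have "sum L {..m} = (1 - y) / (1 - q) * (1 / q ^ m *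
      (\<Prod>i<m. 1 - (1 - y) ^ 2 * q ^ (2 * i + 2) / (y * (1 - q ^ (2 * i + 2)) ^ 2)) *
      (E m ^ 3 / prod D {..<m}) * S)"
    by (simp only: times_divide_eq_left times_divide_eq_right)
  then show ?thesis
    unfolding L_def S_def EE .
qed

section \<open>The perturbed sum near a primitive root of unity\<close>

context
  fixes z :: complex and m n :: nat and y \<delta> :: "rat poly fract"
  assumes z: "z \<in> primitive_roots_unity n" and n: "n = 2 * m + 1" and m: "m > 0"
  defines "y \<equiv> qvar ^ n" and "\<delta> \<equiv> (1 - y) ^ 3 / y"
begin

lemma has_value_y: "has_value z y 1"
  using has_value_power[OF has_value_qvar[of z], of n] z
  by (simp add: y_def primitive_roots_unity_def)

lemma vanishes_eps: "vanishes z 1 (1 - y)"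
  using has_value_diff[OF has_value_1 has_value_y] by (intro has_value_0_imp_vanishes) simp

lemma vanishes_delta: "vanishes z 3 \<delta>"
  unfolding \<delta>_def using vanishes_power[OF vanishes_eps, of 3] has_value_y
  by (auto intro: vanishes_divide)

lemma has_value_delta: "has_value z \<delta> 0"
  by (rule vanishes_imp_has_value_0[OF vanishes_delta]) simp

lemma even_power_neq_1: "i < m \<Longrightarrow> z ^ (2 * i + 2) \<noteq> 1"
  and odd_power_neq_1: "i < m \<Longrightarrow> z ^ (2 * i + 1) \<noteq> 1"
  by (rule root_power_neq_1[OF z n]; simp add: n)+

lemma has_value_even_factor: "has_value z (1 - qvar ^ (2 * i + 2)) (1 - z ^ (2 * i + 2))"
  and has_value_odd_factor: "has_value z (1 - qvar ^ (2 * i + 1)) (1 - z ^ (2 * i + 1))"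
  by (intro has_value_intros)+

lemma has_value_numerator_factor:
  "has_value z ((1 - qvar ^ (2 * i + 1)) ^ 3 - qvar ^ (2 * i + 1) * \<delta>) ((1 - z ^ (2 * i + 1)) ^ 3)"
proof -
  have "has_value z ((1 - qvar ^ (2 * i + 1)) ^ 3 - qvar ^ (2 * i + 1) * \<delta>)
      ((1 - z ^ (2 * i + 1)) ^ 3 - z ^ (2 * i + 1) * 0)"
    by (intro has_value_intros has_value_delta)
  then show ?thesis
    by simp
qed

lemma has_value_denominator_factor:
  "has_value z ((1 - qvar ^ (2 * i + 2)) ^ 3 + (qvar ^ (2 * i + 2)) ^ 2 * \<delta>) ((1 - z ^ (2 * i + 2)) ^ 3)"
proof -
  have "has_value z ((1 - qvar ^ (2 * i + 2)) ^ 3 + (qvar ^ (2 * i + 2)) ^ 2 * \<delta>)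
      ((1 - z ^ (2 * i + 2)) ^ 3 + (z ^ (2 * i + 2)) ^ 2 * 0)"
    by (intro has_value_intros has_value_delta)
  then show ?thesis
    by simp
qed

lemma vanishes_numerator_prod:
  "vanishes z 3 ((\<Prod>i<k. (1 - qvar ^ (2 * i + 1)) ^ 3 - qvar ^ (2 * i + 1) * \<delta>) -
     (\<Prod>i<k. 1 - qvar ^ (2 * i + 1)) ^ 3)"
  unfolding prod_power_distrib
proof (rule vanishes_prod_diff)
  fix i
  show "vanishes z 0 ((1 - qvar ^ (2 * i + 1)) ^ 3 - qvar ^ (2 * i + 1) * \<delta>)"
    by (rule has_value_imp_regular[OF has_value_numerator_factor])
  show "vanishes z 0 ((1 - qvar ^ (2 * i + 1)) ^ 3)"
    by (rule has_value_imp_regular[OF has_value_power[OF has_value_odd_factor]])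
  show "vanishes z 3 ((1 - qvar ^ (2 * i + 1)) ^ 3 - qvar ^ (2 * i + 1) * \<delta> - (1 - qvar ^ (2 * i + 1)) ^ 3)"
    using vanishes_uminus[OF vanishes_regular_mult[OF has_value_imp_regular[OF
      has_value_power[OF has_value_qvar, where k = "2 * i + 1"]] vanishes_delta]]
    by simp
qed

lemma vanishes_denominator_prod:
  "vanishes z 3 ((\<Prod>i<k. (1 - qvar ^ (2 * i + 2)) ^ 3 + (qvar ^ (2 * i + 2)) ^ 2 * \<delta>) -
     (\<Prod>i<k. 1 - qvar ^ (2 * i + 2)) ^ 3)"
  unfolding prod_power_distrib
proof (rule vanishes_prod_diff)
  fix i
  show "vanishes z 0 ((1 - qvar ^ (2 * i + 2)) ^ 3 + (qvar ^ (2 * i + 2)) ^ 2 * \<delta>)"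
    by (rule has_value_imp_regular[OF has_value_denominator_factor])
  show "vanishes z 0 ((1 - qvar ^ (2 * i + 2)) ^ 3)"
    by (rule has_value_imp_regular[OF has_value_power[OF has_value_even_factor]])
  show "vanishes z 3 ((1 - qvar ^ (2 * i + 2)) ^ 3 + (qvar ^ (2 * i + 2)) ^ 2 * \<delta> - (1 - qvar ^ (2 * i + 2)) ^ 3)"
    using vanishes_regular_mult[OF has_value_imp_regular[OF
      has_value_power[OF has_value_power[OF has_value_qvar, where k = "2 * i + 2"], where k = 2]] vanishes_delta]
    by simp
qed

lemma even_prod_neq_0: "k \<le> m \<Longrightarrow> (\<Prod>i<k. (1 - z ^ (2 * i + 2)) ^ 3) \<noteq> 0"
  "k \<le> m \<Longrightarrow> (\<Prod>i<k. 1 - z ^ (2 * i + 2)) \<noteq> 0"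
  using even_power_neq_1 by auto

text \<open>
  The perturbation has relative size \<open>\<delta>\<close>, and to first order in \<open>\<delta>\<close> the weights it
  introduces are symmetric under \<open>k \<mapsto> m - k\<close>, whereas the summands themselves are antisymmetric
  at \<open>z\<close>; hence the sum changes only by a term of order four.
\<close>

lemma vanishes_perturbation:
  "vanishes z 4 ((\<Sum>k\<le>m. qterm qvar k) -
    (\<Sum>k\<le>m. (1 - qvar ^ (4 * k + 1)) / (1 - qvar) * qratio qvar k *
      ((\<Prod>i<k. (1 - qvar ^ (2 * i + 1)) ^ 3 - qvar ^ (2 * i + 1) * \<delta>) /
       (\<Prod>i<k. (1 - qvar ^ (2 * i + 2)) ^ 3 + (qvar ^ (2 * i + 2)) ^ 2 * \<delta>)) *
      qvar ^ (2 * k ^ 2 + k)))"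
proof -
  define s t where "s = (\<lambda>i. qvar ^ (2 * i + 1))" and "t = (\<lambda>i. qvar ^ (2 * i + 2))"
  define g where "g = (\<lambda>i. s i / (1 - s i) ^ 3 + t i ^ 2 / (1 - t i) ^ 3)"
  \<comment> \<open>Chosen so that \<open>1 + \<delta> * h i\<close> is exactly the relative change
    of the \<open>i\<close>-th factor. Its denominator has value 1 at \<open>z\<close>, so there
    \<open>h i\<close> becomes minus a term of \<open>cubic_sum\<close>.\<close>
  define h where "h = (\<lambda>i. - g i / (1 + \<delta> * (t i ^ 2 / (1 - t i) ^ 3)))"
  define r where "r = (\<lambda>k. \<Prod>i<k. 1 + \<delta> * h i)"
  define H where "H = (\<lambda>k. \<Sum>i<k. h i)"
  have s1: "1 - s i \<noteq> 0" and t1: "1 - t i \<noteq> 0" for i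
    using qvar_power_neq_1[of "2 * i + 1"] qvar_power_neq_1[of "2 * i + 2"] by (simp_all add: s_def t_def)
  have g: "has_value z (g i) (z ^ (2 * i + 1) / (1 - z ^ (2 * i + 1)) ^ 3 +
      (z ^ (2 * i + 2)) ^ 2 / (1 - z ^ (2 * i + 2)) ^ 3)"
    and d: "has_value z (1 + \<delta> * (t i ^ 2 / (1 - t i) ^ 3)) 1" if "i < m" for i
  proof -
    have b: "has_value z (t i ^ 2 / (1 - t i) ^ 3) ((z ^ (2 * i + 2)) ^ 2 / (1 - z ^ (2 * i + 2)) ^ 3)"
      unfolding t_def using even_power_neq_1[OF that]
      by (intro has_value_divide has_value_intros) simp
    have "has_value z (s i / (1 - s i) ^ 3) (z ^ (2 * i + 1) / (1 - z ^ (2 * i + 1)) ^ 3)"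
      unfolding s_def using odd_power_neq_1[OF that]
      by (intro has_value_divide has_value_intros) simp
    then show "has_value z (g i) (z ^ (2 * i + 1) / (1 - z ^ (2 * i + 1)) ^ 3 +
      (z ^ (2 * i + 2)) ^ 2 / (1 - z ^ (2 * i + 2)) ^ 3)"
      unfolding g_def using b by (rule has_value_add)
    show "has_value z (1 + \<delta> * (t i ^ 2 / (1 - t i) ^ 3)) 1"
      using has_value_add[OF has_value_1 has_value_mult[OF has_value_delta b]] by simp
  qed
  have h: "has_value z (h i) (- (z ^ (2 * i + 1) / (1 - z ^ (2 * i + 1)) ^ 3 +
      (z ^ (2 * i + 2)) ^ 2 / (1 - z ^ (2 * i + 2)) ^ 3))" if "i < m" for i
    unfolding h_def using has_value_divide[OF has_value_uminus[OF g[OF that]] d[OF that]] by simp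
  have H: "has_value z (H k) (- cubic_sum z k)" if "k \<le> m" for k
    unfolding H_def cubic_sum_def sum_negf[symmetric] by (intro has_value_sum h) (use that in auto)
  have ratio: "(1 - qvar ^ (4 * k + 1)) / (1 - qvar) * qratio qvar k *
      ((\<Prod>i<k. (1 - s i) ^ 3 - s i * \<delta>) / (\<Prod>i<k. (1 - t i) ^ 3 + t i ^ 2 * \<delta>)) *
      qvar ^ (2 * k ^ 2 + k) = qterm qvar k * r k" if "k \<le> m" for k
  proof -
    have factor: "((1 - s i) ^ 3 - s i * \<delta>) / ((1 - t i) ^ 3 + t i ^ 2 * \<delta>) =
        ((1 - s i) / (1 - t i)) ^ 3 * (1 + \<delta> * h i)" if "i < m" for i
    proof -
      define a b where "a = s i / (1 - s i) ^ 3" and "b = t i ^ 2 / (1 - t i) ^ 3"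
      have ne: "1 + \<delta> * b \<noteq> 0"
        using has_value_nonzero[OF d[OF that]] by (simp add: b_def)
      have "(1 - s i) ^ 3 - s i * \<delta> = (1 - s i) ^ 3 * (1 - \<delta> * a)"
        "(1 - t i) ^ 3 + t i ^ 2 * \<delta> = (1 - t i) ^ 3 * (1 + \<delta> * b)"
        using s1[of i] t1[of i] by (simp_all add: a_def b_def right_diff_distrib distrib_left mult.commute)
      moreover have "1 + \<delta> * h i = (1 - \<delta> * a) / (1 + \<delta> * b)"
        using ne unfolding h_def g_def a_def[symmetric] b_def[symmetric]
        by (simp add: add_divide_eq_iff) (simp add: algebra_simps)
      ultimately show ?thesis
        by (simp add: power_divide)
    qed
    have "(\<Prod>i<k. (1 - s i) ^ 3 - s i * \<delta>) / (\<Prod>i<k. (1 - t i) ^ 3 + t i ^ 2 * \<delta>) =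
        (\<Prod>i<k. ((1 - s i) / (1 - t i)) ^ 3 * (1 + \<delta> * h i))"
      unfolding prod_dividef[symmetric] by (intro prod.cong refl factor) (use that in auto)
    also have "\<dots> = qratio qvar k ^ 3 * r k"
      by (simp only: prod.distrib qratio_def r_def s_def t_def prod_power_distrib)
    finally have eq: "(\<Prod>i<k. (1 - s i) ^ 3 - s i * \<delta>) / (\<Prod>i<k. (1 - t i) ^ 3 + t i ^ 2 * \<delta>) =
        qratio qvar k ^ 3 * r k" .
    have "qratio qvar k ^ 4 = qratio qvar k * qratio qvar k ^ 3"
      by (simp add: power_numeral_reduce)
    then show ?thesis
      unfolding eq qterm_def by (simp only: mult_ac)
  qed
  have qterm: "has_value z (qterm qvar k) (qterm z k)" if km: "k \<le> m" for k
  proof -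
    have kn: "k < n"
      using km n by simp
    obtain x where "qterm qvar (0 * n + k) = qratio qvar (0 * n) ^ 4 * x" "has_value z x (qterm z k)"
      by (rule has_value_qterm_block[OF z n kn m, of 0])
    then show ?thesis
      by (simp add: qratio_def)
  qed
  have first: "vanishes z 6 (r k - (1 + \<delta> * H k))" if "k \<le> m" for k
    using vanishes_prod_first_order[OF vanishes_delta, of k h] has_value_imp_regular[OF h] that
    by (simp add: r_def H_def)
  have "has_value z (\<Sum>k\<le>m. qterm qvar k * H k) (\<Sum>k\<le>m. qterm z k * - cubic_sum z k)"
    by (intro has_value_sum has_value_mult qterm H) auto
  also have "(\<Sum>k\<le>m. qterm z k * - cubic_sum z k) = 0"
    by (rule qterm_weighted_sum_eq_0[OF z n]) (simp add: cubic_sum_reflect[OF z n])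
  finally have "vanishes z (3 + 1) (\<delta> * (\<Sum>k\<le>m. qterm qvar k * H k))"
    by (intro vanishes_mult vanishes_delta has_value_0_imp_vanishes)
  moreover have "vanishes z 4 (\<Sum>k\<le>m. qterm qvar k * (r k - (1 + \<delta> * H k)))"
  proof (intro vanishes_sum vanishes_regular_mult)
    fix k assume "k \<in> {..m}"
    then show "vanishes z 0 (qterm qvar k)" "vanishes z 4 (r k - (1 + \<delta> * H k))"
      using has_value_imp_regular[OF qterm] vanishes_mono[OF first] by auto
  qed
  ultimately have "vanishes z 4 (- ((\<Sum>k\<le>m. qterm qvar k * (r k - (1 + \<delta> * H k))) +
      \<delta> * (\<Sum>k\<le>m. qterm qvar k * H k)))"
    by (intro vanishes_uminus vanishes_add) simp_all
  also have "- ((\<Sum>k\<le>m. qterm qvar k * (r k - (1 + \<delta> * H k))) + \<delta> * (\<Sum>k\<le>m. qterm qvar k * H k)) =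
      (\<Sum>k\<le>m. qterm qvar k) - (\<Sum>k\<le>m. qterm qvar k * r k)"
    by (simp add: sum_distrib_left algebra_simps sum_subtractf sum.distrib)
  also have "(\<Sum>k\<le>m. qterm qvar k * r k) = (\<Sum>k\<le>m. (1 - qvar ^ (4 * k + 1)) / (1 - qvar) * qratio qvar k *
      ((\<Prod>i<k. (1 - s i) ^ 3 - s i * \<delta>) / (\<Prod>i<k. (1 - t i) ^ 3 + t i ^ 2 * \<delta>)) *
      qvar ^ (2 * k ^ 2 + k))"
    by (intro sum.cong refl ratio[symmetric]) simp
  finally show ?thesis
    unfolding s_def t_def .
qed

text \<open>The product is expanded to first order in (1 - y)^2. Replacing the first-order
  coefficient by its value at \<open>z\<close>, a constant supplied by
  \<open>sum_root_inverse_squares\<close>, leaves an error of order 2 + 1.\<close>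

lemma vanishes_correction:
  "vanishes z 3 ((\<Prod>i<m. 1 - (1 - y) ^ 2 * qvar ^ (2 * i + 2) / (y * (1 - qvar ^ (2 * i + 2)) ^ 2)) -
    (1 + (1 - y) ^ 2 * ((of_nat n ^ 2 - 1) / 24)))"
proof -
  define h where "h = (\<lambda>i. - (qvar ^ (2 * i + 2) / (y * (1 - qvar ^ (2 * i + 2)) ^ 2)))"
  have h: "has_value z (h i) (- (z ^ (2 * i + 2) / (1 * (1 - z ^ (2 * i + 2)) ^ 2)))" if "i < m" for i
    unfolding h_def using even_power_neq_1[OF that]
    by (intro has_value_uminus has_value_divide has_value_mult has_value_y has_value_power
          has_value_diff has_value_1 has_value_qvar) simp
  have sq: "vanishes z 2 ((1 - y) ^ 2)"
    using vanishes_power[OF vanishes_eps, of 2] by simp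
  have 1: "vanishes z 3 ((\<Prod>i<m. 1 + (1 - y) ^ 2 * h i) - (1 + (1 - y) ^ 2 * (\<Sum>i<m. h i)))"
    using vanishes_prod_first_order[OF sq, of m h] has_value_imp_regular[OF h]
    by (auto intro: vanishes_mono)
  have "has_value z ((\<Sum>i<m. h i) - (of_nat n ^ 2 - 1) / 24)
      ((\<Sum>i<m. - (z ^ (2 * i + 2) / (1 * (1 - z ^ (2 * i + 2)) ^ 2))) - (of_nat n ^ 2 - 1) / 24)"
    by (intro has_value_diff has_value_sum h has_value_divide has_value_power has_value_of_nat
          has_value_1 has_value_numeral) auto
  also have "(\<Sum>i<m. - (z ^ (2 * i + 2) / (1 * (1 - z ^ (2 * i + 2)) ^ 2))) - (of_nat n ^ 2 - 1) / 24 = 0"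
    using sum_root_inverse_squares[OF z n] by (simp add: sum_negf)
  finally have "vanishes z (2 + 1) ((1 - y) ^ 2 * ((\<Sum>i<m. h i) - (of_nat n ^ 2 - 1) / 24))"
    by (intro vanishes_mult sq has_value_0_imp_vanishes)
  then have "vanishes z 3 (((\<Prod>i<m. 1 + (1 - y) ^ 2 * h i) - (1 + (1 - y) ^ 2 * (\<Sum>i<m. h i))) +
      (1 - y) ^ 2 * ((\<Sum>i<m. h i) - (of_nat n ^ 2 - 1) / 24))"
    using 1 by (intro vanishes_add) simp_all
  also have "((\<Prod>i<m. 1 + (1 - y) ^ 2 * h i) - (1 + (1 - y) ^ 2 * (\<Sum>i<m. h i))) +
      (1 - y) ^ 2 * ((\<Sum>i<m. h i) - (of_nat n ^ 2 - 1) / 24) =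
      (\<Prod>i<m. 1 + (1 - y) ^ 2 * h i) - (1 + (1 - y) ^ 2 * ((of_nat n ^ 2 - 1) / 24))"
    by (simp add: right_diff_distrib)
  finally show ?thesis
    by (simp add: h_def)
qed

end

section \<open>The congruence\<close>

lemma qint_qvar: "qint qvar k = (1 - qvar ^ k) / (1 - qvar)"
  by (simp add: qint_def)

lemma summand_eq_qterm:
  "qint qvar (4 * k + 1)
       * (qpochhammer qvar (qvar ^ 2) k ^ 4 / qpochhammer (qvar ^ 2) (qvar ^ 2) k ^ 4)
       * qvar ^ (2 * k ^ 2 + k) = qterm qvar k"
  by (simp add: qterm_def qratio_qpochhammer qint_qvar power_divide)

context
  fixes z :: complex and m n :: nat
  assumes z: "z \<in> primitive_roots_unity n" and n: "n = 2 * m + 1" and m: "m > 0"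
begin

lemma vanishes_qint:
  assumes "n dvd k"
  shows "vanishes z 1 (qint qvar k)"
proof -
  have "z \<noteq> 1"
    using root_power_neq_1[OF z n, of 1] n m by simp
  then have "has_value z (qint qvar k) ((1 - z ^ k) / (1 - z))"
    unfolding qint_qvar by (intro has_value_divide has_value_intros) simp
  moreover have "z ^ k = 1"
    using primitive_root_power_eq_1_iff[OF z] n assms by simp
  ultimately show ?thesis
    by (intro has_value_0_imp_vanishes) simp
qed

lemma regular_inverse_power: "vanishes z 0 (1 / qvar ^ k)"
  using root_nonzero[OF z n]
  by (intro has_value_imp_regular[OF has_value_divide[OF has_value_1 has_value_power[OF has_value_qvar]]]) simp

text \<open>\<open>k\<close> and \<open>l\<close> are independent of the order of \<open>z\<close>,
  since the same statement is applied at roots whose order is a proper divisor of the index in the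
  congruence.\<close>

lemma regular_correction: "vanishes z 0 (1 + qint qvar k ^ 2 * ((of_nat l ^ 2 - 1) * (1 - qvar) ^ 2 / 24))"
proof -
  have "z \<noteq> 1"
    using root_power_neq_1[OF z n, of 1] n m by simp
  then show ?thesis
    unfolding qint_qvar
    by (intro has_value_imp_regular[of _ _ "1 + ((1 - z ^ k) / (1 - z)) ^ 2 * ((of_nat l ^ 2 - 1) * (1 - z) ^ 2 / 24)"]
         has_value_divide has_value_intros) simp_all
qed

text \<open>The grouping into \<open>qratio\<close> squared times a polynomial is essential: the
  denominator alone vanishes at \<open>z\<close> once \<open>k\<close> reaches \<open>n\<close>, as
  happens at roots of smaller order.\<close>

lemma regular_rhs_sum:
  "vanishes z 0 (\<Sum>k\<in>A. qpochhammer qvar (qvar ^ 2) k ^ 3 / qpochhammer (qvar ^ 2) (qvar ^ 2) k ^ 2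
            * qvar ^ (2 * k))"
proof (rule vanishes_sum)
  fix k
  have "vanishes z 0 (qpochhammer qvar (qvar ^ 2) k)"
    unfolding qpochhammer_odd
    by (intro regular_prod
        has_value_imp_regular[OF has_value_diff[OF has_value_1 has_value_power[OF has_value_qvar]]])
  then have "vanishes z 0 (qratio qvar k ^ 2 * qpochhammer qvar (qvar ^ 2) k * qvar ^ (2 * k))"
    using vanishes_power[OF regular_qratio[OF z n, of k], of 2]
    by (intro vanishes_mult_regular has_value_imp_regular[OF has_value_power[OF has_value_qvar]]) simp_all
  then show "vanishes z 0 (qpochhammer qvar (qvar ^ 2) k ^ 3 / qpochhammer (qvar ^ 2) (qvar ^ 2) k ^ 2
            * qvar ^ (2 * k))"
    by (simp add: qratio_qpochhammer power_divide power3_eq_cube power2_eq_square)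
qed

text \<open>The exact evaluation of the perturbed sum carries the factor [n], which already vanishes
  at \<open>z\<close>. The remaining factors \<open>Q\<close>, \<open>W\<close>, \<open>S\<close>
  therefore need to match \<open>C\<close>, 1, \<open>S0\<close> only to order three.\<close>

lemma vanishes_difference:
  assumes M: "M = m \<or> M = n - 1"
  defines "C \<equiv> 1 + qint qvar n ^ 2 * ((of_nat n ^ 2 - 1) * (1 - qvar) ^ 2 / 24)"
    and "S0 \<equiv> \<Sum>k\<le>m. qpochhammer qvar (qvar ^ 2) k ^ 3 / qpochhammer (qvar ^ 2) (qvar ^ 2) k ^ 2 * qvar ^ (2 * k)"
  shows "vanishes z 4 ((\<Sum>k\<le>M. qterm qvar k) - qint qvar n * (1 / qvar ^ m) * C * S0)"
proof -
  define y where "y = qvar ^ n"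
  define \<delta> where "\<delta> = (1 - y) ^ 3 / y"
  define N where "N = (\<lambda>i. (1 - qvar ^ (2 * i + 1)) ^ 3 - qvar ^ (2 * i + 1) * \<delta>)"
  define D where "D = (\<lambda>i. (1 - qvar ^ (2 * i + 2)) ^ 3 + (qvar ^ (2 * i + 2)) ^ 2 * \<delta>)"
  define E where "E = (\<lambda>k. \<Prod>i<k. 1 - qvar ^ (2 * i + 2))"
  define O' where "O' = (\<lambda>k. \<Prod>i<k. 1 - qvar ^ (2 * i + 1))"
  define Q where "Q = (\<Prod>i<m. 1 - (1 - y) ^ 2 * qvar ^ (2 * i + 2) / (y * (1 - qvar ^ (2 * i + 2)) ^ 2))"
  define W where "W = E m ^ 3 / prod D {..<m}"
  define S where "S = (\<Sum>j\<le>m. prod N {..<j} * qvar ^ (2 * j) / E j ^ 2)"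
  define T where "T = (\<Sum>k\<le>m. (1 - qvar ^ (4 * k + 1)) / (1 - qvar) * qratio qvar k *
      (prod N {..<k} / prod D {..<k}) * qvar ^ (2 * k ^ 2 + k))"
  have D_value: "has_value z (D i) ((1 - z ^ (2 * i + 2)) ^ 3)" for i
    unfolding D_def \<delta>_def y_def by (rule has_value_denominator_factor[OF z n m])
  have "D i \<noteq> 0" if "i < m" for i
    by (rule has_value_nonzero[OF D_value]) (use even_power_neq_1[OF z n m that] in simp)
  then have T: "T = qint qvar n * (1 / qvar ^ m * Q * W * S)"
    unfolding T_def Q_def W_def S_def E_def N_def D_def \<delta>_def y_def n qint_qvar
    by (intro watson_half qvar_nonzero qvar_power_neq_1)
  \<comment> \<open>This makes the two truncations equivalent: between \<open>m\<close> and
    \<open>n\<close> the quotient \<open>qratio\<close> vanishes at \<open>z\<close>, and it enters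
    each summand to the fourth power.\<close>
  have tail: "vanishes z 4 ((\<Sum>k\<le>M. qterm qvar k) - (\<Sum>k\<le>m. qterm qvar k))"
  proof -
    have beyond: "vanishes z 4 (qterm qvar k)" if "m < k" "k < n" for k
    proof -
      have "has_value z (qratio qvar k) 0"
        using has_value_qratio[OF z n that(2)] qratio_eq_0[OF z n that(1)] by simp
      then have u: "vanishes z 4 (qratio qvar k ^ 4)"
        using vanishes_power[OF has_value_0_imp_vanishes, of z _ 4] by simp
      have "z \<noteq> 1"
        using root_power_neq_1[OF z n, of 1] n m by simp
      then have "vanishes z 0 ((1 - qvar ^ (4 * k + 1)) / (1 - qvar))"
        by (intro has_value_imp_regular[OF has_value_divide[of _ _ "1 - z ^ (4 * k + 1)" _ "1 - z"]] has_value_intros) simp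
      then show ?thesis
        unfolding qterm_def using u
        by (intro vanishes_mult_regular vanishes_regular_mult has_value_imp_regular[OF has_value_power[OF has_value_qvar]])
    qed
    have "m \<le> M" "M < n"
      using M n by auto
    then have "(\<Sum>k\<le>M. qterm qvar k) - (\<Sum>k\<le>m. qterm qvar k) = (\<Sum>k\<in>{..M} - {..m}. qterm qvar k)"
      by (intro sum_diff[symmetric]) auto
    moreover have "vanishes z 4 (\<Sum>k\<in>{..M} - {..m}. qterm qvar k)"
      by (intro vanishes_sum beyond) (use \<open>M < n\<close> in auto)
    ultimately show ?thesis
      by simp
  qed
  have pert: "vanishes z 4 ((\<Sum>k\<le>m. qterm qvar k) - T)"
    unfolding T_def N_def D_def \<delta>_def y_def by (rule vanishes_perturbation[OF z n m])
  have E_value: "has_value z (E k) (\<Prod>i<k. 1 - z ^ (2 * i + 2))" for k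
    unfolding E_def by (intro has_value_prod has_value_intros)
  have DP_value: "has_value z (prod D {..<k}) (\<Prod>i<k. (1 - z ^ (2 * i + 2)) ^ 3)" for k
    by (intro has_value_prod D_value)
  have W1: "vanishes z 3 (W - 1)"
  proof -
    have "vanishes z 3 (prod D {..<m} - E m ^ 3)"
      unfolding D_def E_def \<delta>_def y_def by (rule vanishes_denominator_prod[OF z n m])
    then have "vanishes z 3 (- ((prod D {..<m} - E m ^ 3) / prod D {..<m}))"
      using vanishes_divide[OF _ DP_value even_prod_neq_0(1)[OF z n m order_refl]] vanishes_uminus by blast
    moreover have "prod D {..<m} \<noteq> 0"
      by (rule has_value_nonzero[OF DP_value even_prod_neq_0(1)[OF z n m order_refl]])
    ultimately show ?thesis
      by (simp add: W_def diff_divide_distrib)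
  qed
  have NP: "vanishes z 3 (prod N {..<k} - O' k ^ 3)" for k
    unfolding N_def O'_def \<delta>_def y_def by (rule vanishes_numerator_prod[OF z n m])
  have S0: "S0 = (\<Sum>j\<le>m. O' j ^ 3 * qvar ^ (2 * j) / E j ^ 2)"
    unfolding S0_def O'_def E_def qpochhammer_odd qpochhammer_even by simp
  have S1: "vanishes z 3 (S - S0)"
    unfolding S_def S0 sum_subtractf[symmetric]
  proof (rule vanishes_sum)
    fix j assume "j \<in> {..m}"
    then have j: "j \<le> m" by simp
    have "(\<Prod>i<j. 1 - z ^ (2 * i + 2)) ^ 2 \<noteq> 0"
      by (rule power_not_zero[OF even_prod_neq_0(2)[OF z n m j]])
    then have "vanishes z 3 ((prod N {..<j} - O' j ^ 3) * qvar ^ (2 * j) / E j ^ 2)"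
      by (intro vanishes_divide[OF _ has_value_power[OF E_value]] vanishes_mult_regular NP
          has_value_imp_regular[OF has_value_power[OF has_value_qvar]])
    then show "vanishes z 3 (prod N {..<j} * qvar ^ (2 * j) / E j ^ 2 - O' j ^ 3 * qvar ^ (2 * j) / E j ^ 2)"
      by (simp add: left_diff_distrib diff_divide_distrib)
  qed
  have C: "C = 1 + (1 - y) ^ 2 * ((of_nat n ^ 2 - 1) / 24)"
  proof -
    have "qint qvar n ^ 2 * (1 - qvar) ^ 2 = (1 - y) ^ 2"
      using qvar_power_neq_1[of 1] by (simp add: qint_qvar y_def power_divide)
    then show ?thesis
      unfolding C_def by (simp add: mult.commute mult.left_commute)
  qed
  have Q1: "vanishes z 3 (Q - C)"
    unfolding Q_def C y_def by (rule vanishes_correction[OF z n m])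
  have reg_C: "vanishes z 0 C"
    unfolding C_def by (rule regular_correction)
  have reg_S0: "vanishes z 0 S0"
    unfolding S0_def by (rule regular_rhs_sum)
  have reg_S: "vanishes z 0 S"
    using vanishes_add[OF vanishes_mono[OF S1, of 0] reg_S0] by simp
  have reg_W: "vanishes z 0 W"
    using vanishes_add[OF vanishes_mono[OF W1, of 0] has_value_imp_regular[OF has_value_1]] by simp
  \<comment> \<open>\<open>Q * W * S - C * S0\<close>, with the factors replaced one at a
    time.\<close>
  have "vanishes z 3 ((Q - C) * (W * S) + C * ((W - 1) * S + (S - S0)))"
    by (intro vanishes_add vanishes_mult_regular[OF Q1] vanishes_regular_mult[OF reg_C]
        vanishes_mult_regular[OF W1] S1 vanishes_mult_regular[OF reg_W] reg_S)
  then have "vanishes z (1 + (0 + 3)) (qint qvar n * (1 / qvar ^ m * ((Q - C) * (W * S) + C * ((W - 1) * S + (S - S0)))))"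
    by (intro vanishes_mult vanishes_qint regular_inverse_power) simp_all
  also have "qint qvar n * (1 / qvar ^ m * ((Q - C) * (W * S) + C * ((W - 1) * S + (S - S0)))) =
      T - qint qvar n * (1 / qvar ^ m) * C * S0"
    unfolding T by (simp only: algebra_simps)
  finally have main: "vanishes z 4 (T - qint qvar n * (1 / qvar ^ m) * C * S0)"
    by simp
  show ?thesis
    using vanishes_add[OF vanishes_add[OF tail pert] main] by (simp add: algebra_simps)
qed

end

theorem corollary2p6:
  fixes n M :: nat
  assumes "n > 0" and "odd n" and "M = (n - 1) div 2 \<or> M = n - 1"
  shows "fract_cong
    (\<Sum>k=0..M. qint qvar (4 * k + 1)
       * (qpochhammer qvar (qvar ^ 2) k ^ 4 / qpochhammer (qvar ^ 2) (qvar ^ 2) k ^ 4)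
       * qvar ^ (2 * k ^ 2 + k))
    (qint qvar n * qvar powi ((1 - int n) div 2)
       * (1 + qint qvar n ^ 2 * ((of_nat n ^ 2 - 1) * (1 - qvar) ^ 2 / 24))
       * (\<Sum>k=0..(n - 1) div 2.
            qpochhammer qvar (qvar ^ 2) k ^ 3 / qpochhammer (qvar ^ 2) (qvar ^ 2) k ^ 2
            * qvar ^ (2 * k)))
    (qint [:0, 1:] n * cyclotomic n ^ 3)"
proof -
  obtain m where n: "n = 2 * m + 1"
    using assms(2) by (auto elim: oddE)
  have "(1 - int n) div 2 = - int m"
    by (simp add: n)
  then have half: "(n - 1) div 2 = m" and powi: "qvar powi ((1 - int n) div 2) = 1 / qvar ^ m"
    by (simp_all add: n power_int_minus inverse_eq_divide)
  have M: "M = m \<or> M = n - 1"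
    using assms(3) half by simp
  show ?thesis
    unfolding summand_eq_qterm half powi atLeast0AtMost
  proof (cases "m = 0")
    case True
    then have "M = 0" "n = 1"
      using M n by auto
    have "1 - qvar \<noteq> 0"
      using qvar_power_neq_1[of 1] by simp
    then show "fract_cong (sum (qterm qvar) {..M})
      (qint qvar n * (1 / qvar ^ m)
       * (1 + qint qvar n ^ 2 * ((of_nat n ^ 2 - 1) * (1 - qvar) ^ 2 / 24))
       * (\<Sum>k\<le>m. qpochhammer qvar (qvar ^ 2) k ^ 3 / qpochhammer (qvar ^ 2) (qvar ^ 2) k ^ 2
            * qvar ^ (2 * k)))
      (qint [:0, 1:] n * cyclotomic n ^ 3)"
      unfolding True \<open>M = 0\<close> \<open>n = 1\<close> by (simp add: fract_cong_def qterm_def qratio_def qint_qvar)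
  next
    case False
    then have m: "m > 0" by simp
    show "fract_cong (sum (qterm qvar) {..M})
      (qint qvar n * (1 / qvar ^ m)
       * (1 + qint qvar n ^ 2 * ((of_nat n ^ 2 - 1) * (1 - qvar) ^ 2 / 24))
       * (\<Sum>k\<le>m. qpochhammer qvar (qvar ^ 2) k ^ 3 / qpochhammer (qvar ^ 2) (qvar ^ 2) k ^ 2
            * qvar ^ (2 * k)))
      (qint [:0, 1:] n * cyclotomic n ^ 3)"
    proof (rule fract_cong_if_vanishes)
      show "n > 1"
        using n m by simp
    next
      fix z assume "z \<in> primitive_roots_unity n"
      from vanishes_difference[OF this n m M]
      show "vanishes z 4 (sum (qterm qvar) {..M} - qint qvar n * (1 / qvar ^ m)
         * (1 + qint qvar n ^ 2 * ((of_nat n ^ 2 - 1) * (1 - qvar) ^ 2 / 24))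
         * (\<Sum>k\<le>m. qpochhammer qvar (qvar ^ 2) k ^ 3 / qpochhammer (qvar ^ 2) (qvar ^ 2) k ^ 2
            * qvar ^ (2 * k)))" .
    next
      fix d z assume d: "d dvd n" "1 < d" "d < n" and z: "z \<in> primitive_roots_unity d"
      obtain e where e: "n = d * e"
        using d(1) by (elim dvdE)
      then have "odd d" "odd e"
        using assms(2) by auto
      then obtain \<mu> L where \<mu>: "d = 2 * \<mu> + 1" and L: "e = 2 * L + 1"
        by (auto elim!: oddE)
      have \<mu>0: "\<mu> > 0"
        using d(2) \<mu> by simp
      \<comment> \<open>Since \<open>d\<close> and \<open>e\<close> are odd, the middle of the range
        of length \<open>n\<close> is the middle of its central block of length \<open>d\<close>. So
        one truncation is \<open>L\<close> full blocks and a half block, the other \<open>e\<close>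
        full blocks.\<close>
      have "m = L * d + \<mu>"
        using n unfolding e L by (simp add: \<mu> algebra_simps)
      then have "{..M} = {..<L * d + Suc \<mu>} \<or> {..M} = {..<e * d + 0}"
        using M n e by (auto simp: lessThan_Suc_atMost[symmetric] mult.commute)
      then have "vanishes z 1 (sum (qterm qvar) {..M})"
        using vanishes_qterm_sum[OF z \<mu> \<mu>0] by metis
      moreover have "vanishes z 1 (qint qvar n * (1 / qvar ^ m)
         * (1 + qint qvar n ^ 2 * ((of_nat n ^ 2 - 1) * (1 - qvar) ^ 2 / 24))
         * (\<Sum>k\<le>m. qpochhammer qvar (qvar ^ 2) k ^ 3 / qpochhammer (qvar ^ 2) (qvar ^ 2) k ^ 2
            * qvar ^ (2 * k)))"
        by (intro vanishes_mult_regular vanishes_qint[OF z \<mu> \<mu>0] regular_inverse_power[OF z \<mu> \<mu>0]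
            regular_correction[OF z \<mu> \<mu>0] regular_rhs_sum[OF z \<mu> \<mu>0] d(1))
      ultimately show "vanishes z 1 (sum (qterm qvar) {..M} - qint qvar n * (1 / qvar ^ m)
         * (1 + qint qvar n ^ 2 * ((of_nat n ^ 2 - 1) * (1 - qvar) ^ 2 / 24))
         * (\<Sum>k\<le>m. qpochhammer qvar (qvar ^ 2) k ^ 3 / qpochhammer (qvar ^ 2) (qvar ^ 2) k ^ 2
            * qvar ^ (2 * k)))"
        by (rule vanishes_diff)
    qed
  qed
qed

end
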